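(* As formal power series in $q$ with coefficients polynomials in $z$: $$\sum_{\lambda\in\mathcal{G}_1'}z^{a(\lambda)}q^{|\lambda|}=\sum_{n=0}^{\infty}\frac{z^nq^{\binom{2n}{2}}(-zq;q^4)_{n}}{(q^4;q^4)_{n}(z^2q^2;q^4)_{n}}=\frac{(-zq;q^4)_{\infty}}{(z^2q^2;q^4)_{\infty}}=\frac{1}{(zq;q^4)_{\infty}(z^2q^6;q^8)_{\infty}},$$ $$\sum_{\lambda\in\mathcal{G}_2'}z^{a(\lambda)}q^{|\lambda|}=\sum_{n=0}^{\infty}\frac{z^{n}q^{\binom{2n+1}{2}}(-zq^{-1};q^4)_{n}}{(q^4;q^4)_{n}(z^2q^2;q^4)_{n}}=\frac{(-zq^3;q^4)_{\infty}}{(z^2q^2;q^4)_{\infty}}=\frac{1}{(zq^3;q^4)_{\infty}(z^2q^2;q^8)_{\infty}},$$ $$\sum_{\lambda\in\mathcal{G}_1'}z^{a(\lambda)}q^{S(\lambda)}=\sum_{n=0}^{\infty}\frac{z^nq^{n^2}(-zq;q^2)_n}{(q^2;q^2)_n(z^2q^2;q^2)_n}=\frac{(-zq;q^2)_{\infty}}{(z^2q^2;q^2)_{\infty}}=\frac{1}{(zq;q^2)_{\infty}(z^2q^4;q^4)_{\infty}},$$ $$\sum_{\lambda\in\mathcal{G}_2'}z^{a(\lambda)}q^{S(\lambda)}=\sum_{n=0}^{\infty}\frac{z^nq^{n^2+n}(-z;q^2)_{n}}{(q^2;q^2)_n(z^2q^2;q^2)_{n}}=\frac{(-zq^2;q^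2)_{\infty}}{(z^2q^2;q^2)_{\infty}}=\frac{1}{(zq^2;q^2)_{\infty}(z^2q^2;q^4)_{\infty}}.$$
   Context: A partition is a finite weakly decreasing sequence of positive integers $\lambda=(\lambda_1,\ldots,\lambda_\ell)$ (the empty partition is included), of weight $|\lambda|=\lambda_1+\cdots+\lambda_\ell$; it is strict if the sequence is strictly decreasing. The odd-indexed parts are $\lambda_1,\lambda_3,\ldots$ and the even-indexed parts are $\lambda_2,\lambda_4,\ldots$. The alternating sum is $a(\lambda)=\lambda_1-\lambda_2+\lambda_3-\cdots+(-1)^{\ell-1}\lambda_\ell$ and the Schmidt weight is $S(\lambda)=\lambda_1+\lambda_3+\lambda_5+\cdots$. $\mathcal{G}_1'$ is the set of strict partitions whose even-indexed parts are all even. $\mathcal{G}_2'$ is the set of strict partitions whose odd-indexed parts are all even. Both contain the empty partition. Notation: $(a;q)_0=1$, $(a;q)_n=\prod_{i=0}^{n-1}(1-aq^i)$, $(a;q)_\infty=\lim_{n\to\infty}(a;q)_n$. Negative powers of $q$ cancel against the monomial prefactors. *)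

theory Defs
  imports
    "HOL-Analysis.Infinite_Sum"
    "HOL-Computational_Algebra.Formal_Laurent_Series"
begin

text \<open>
  A partition is the list of its parts. List positions start at 0, so the odd-indexed parts
  \<open>\<lambda>\<^sub>1, \<lambda>\<^sub>3, \<dots>\<close> sit at the even positions of the list and the even-indexed parts at the odd ones.
\<close>

definition is_partition :: "nat list \<Rightarrow> bool" where
  "is_partition xs \<longleftrightarrow> sorted_wrt (\<ge>) xs \<and> (\<forall>x\<in>set xs. 0 < x)"

definition strict_partition :: "nat list \<Rightarrow> bool" where
  "strict_partition xs \<longleftrightarrow> is_partition xs \<and> sorted_wrt (>) xs"

definition alt_sum :: "nat list \<Rightarrow> int" where
  "alt_sum xs = (\<Sum>i<length xs. (-1) ^ i * int (xs ! i))"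

definition schmidt_weight :: "nat list \<Rightarrow> nat" where
  "schmidt_weight xs = (\<Sum>i | i < length xs \<and> even i. xs ! i)"

definition G1' :: "nat list set" where
  "G1' = {xs. strict_partition xs \<and> (\<forall>i<length xs. odd i \<longrightarrow> even (xs ! i))}"

definition G2' :: "nat list set" where
  "G2' = {xs. strict_partition xs \<and> (\<forall>i<length xs. even i \<longrightarrow> even (xs ! i))}"

text \<open>So \<^term>\<open>nat (alt_sum xs)\<close> loses nothing when used as an exponent.\<close>

lemma alt_sum_Cons: "alt_sum (x # xs) = int x - alt_sum xs"
  unfolding alt_sum_def
  by (simp add: sum.lessThan_Suc_shift sum_negf del: sum.lessThan_Suc)

lemma alt_sum_nonneg: "is_partition xs \<Longrightarrow> 0 \<le> alt_sum xs"
proof -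
  assume "is_partition xs"
  then have "sorted_wrt (\<ge>) xs" by (simp add: is_partition_def)
  then have "0 \<le> alt_sum xs \<and> (xs \<noteq> [] \<longrightarrow> alt_sum xs \<le> int (hd xs))"
  proof (induction xs)
    case Nil
    show ?case by (simp add: alt_sum_def)
  next
    case (Cons x xs)
    have "alt_sum [] = 0" by (simp add: alt_sum_def)
    with Cons show ?case by (cases xs) (auto simp: alt_sum_Cons)
  qed
  then show ?thesis by simp
qed

definition qpoch :: "'a::comm_ring_1 \<Rightarrow> 'a \<Rightarrow> nat \<Rightarrow> 'a" where
  "qpoch a q n = (\<Prod>i<n. 1 - a * q ^ i)"

text \<open>For power series the limit is taken in the \<open>q\<close>-adic metric of the library.\<close>

definition qpoch_inf :: "'a::{comm_ring_1,t2_space} \<Rightarrow> 'a \<Rightarrow> 'a" where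
  "qpoch_inf a q = lim (\<lambda>n. qpoch a q n)"

lemma qpoch_tendsto_qpoch_inf:
  fixes a q :: "'a::comm_ring_1 fps"
  assumes "q $ 0 = 0"
  shows "(\<lambda>n. qpoch a q n) \<longlonglongrightarrow> qpoch_inf a q"
proof -
  have step: "qpoch a q (Suc n) $ k = qpoch a q n $ k" if "k < n" for n k
  proof -
    have low: "(q ^ n) $ j = 0" if "j < n" for j
      using that assms by (simp add: startsby_zero_power_prefix)
    have "(qpoch a q n * a * q ^ n) $ k = 0"
      unfolding fps_mult_nth[of "qpoch a q n * a" "q ^ n"]
      using \<open>k < n\<close> by (intro sum.neutral) (auto simp: low)
    then show ?thesis
      by (simp add: qpoch_def algebra_simps)
  qed
  have stable: "qpoch a q n $ k = qpoch a q (Suc k) $ k" if "Suc k \<le> n" for n k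
    using that by (induction n rule: dec_induct) (auto simp: step)
  have "(\<lambda>n. qpoch a q n) \<longlonglongrightarrow> Abs_fps (\<lambda>k. qpoch a q (Suc k) $ k)"
    unfolding tendsto_fps_iff
    by (auto intro!: eventually_sequentiallyI stable)
  then show ?thesis
    unfolding qpoch_inf_def using limI by metis
qed

text \<open>
  The library's \<^const>\<open>inverse\<close> on \<^typ>\<open>'a fps\<close> needs inverses of coefficients, so it is not available
  for coefficients in \<^typ>\<open>int poly\<close>; \<^term>\<open>fps_left_inverse f 1\<close> is the inverse of a series with
  constant coefficient 1.
\<close>

definition fps_recip :: "'a::comm_ring_1 fps \<Rightarrow> 'a fps" where
  "fps_recip f = fps_left_inverse f 1"

lemma fps_recip: "f $ 0 = 1 \<Longrightarrow> f * fps_recip f = 1"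
  unfolding fps_recip_def by (rule fps_right_inverse'[where y = 1]) auto

text \<open>The two indeterminates of the ring \<^typ>\<open>int poly fps\<close> of power series in \<open>q\<close> over \<open>\<int>[z]\<close>.\<close>

abbreviation zv :: "int poly fps" where
  "zv \<equiv> fps_const [:0, 1:]"

abbreviation qv :: "int poly fps" where
  "qv \<equiv> fps_X"

end

theory Submission
  imports Defs
begin

text \<open>
  The statistics \<open>\<bar>\<lambda>\<bar> = a(\<lambda>) + 2 E(\<lambda>)\<close> and \<open>S(\<lambda>) = a(\<lambda>) + E(\<lambda>)\<close>, where \<open>E\<close> is the sum of the
  even-indexed parts, turn both weights into \<open>s\<^sup>a p\<^sup>E\<close> with \<open>s = zq\<close> and \<open>p = q\<^sup>2\<close> or \<open>p = q\<close>. Such a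
  weight is a product over the columns of the Young diagram. Strictness means that every column
  height up to the number of parts occurs, and the parity conditions say that the multiplicities of
  two neighbouring heights have an even sum. Two neighbouring heights with column weights \<open>x\<close>, \<open>y\<close>
  hence contribute \<open>xy (1 + xy) / ((1 - x\<^sup>2) (1 - y\<^sup>2))\<close>, so grouping the partitions by
  their number of parts produces series of the shape
  \<open>F(y, c) = (\<Sum>n. Q^(n choose 2) (\<Prod>i<n. y + c Q^i) / ((Q; Q)\<^sub>n (c; Q)\<^sub>n))\<close> with \<open>Q = p\<^sup>2\<close>. This limit
  of the q-Gauss sum satisfies \<open>(1 - c) F(y, c) = (1 + y) F(yQ, cQ)\<close>, and iterating this relation
  gives \<open>F(y, c) = (-y; Q)\<^sub>\<infinity> / (c; Q)\<^sub>\<infinity>\<close>. Products and series are compared modulo powers of \<open>q\<close>.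
\<close>

subsection \<open>Unconditional sums of formal power series\<close>

lemma fps_X_power_dvd_iff:
  fixes f :: "'a::comm_ring_1 fps"
  shows "fps_X ^ n dvd f \<longleftrightarrow> (\<forall>k<n. f $ k = 0)"
proof
  assume "fps_X ^ n dvd f"
  then show "\<forall>k<n. f $ k = 0" by (auto simp: fps_X_power_mult_nth elim!: dvdE)
next
  assume *: "\<forall>k<n. f $ k = 0"
  have "f = fps_X ^ n * fps_shift n f"
    using * by (auto simp: fps_eq_iff fps_X_power_mult_nth)
  then show "fps_X ^ n dvd f" by (rule dvdI)
qed

lemma fps_X_power_dvd_diff_iff:
  fixes f g :: "'a::comm_ring_1 fps"
  shows "fps_X ^ n dvd f - g \<longleftrightarrow> (\<forall>k<n. f $ k = g $ k)"
  by (simp add: fps_X_power_dvd_iff)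

lemma fps_X_power_dvd_power:
  fixes f :: "'a::comm_ring_1 fps"
  assumes "f $ 0 = 0"
  shows "fps_X ^ n dvd f ^ n"
proof -
  have "fps_X ^ 1 dvd f" by (subst fps_X_power_dvd_iff) (simp add: assms)
  then show ?thesis by (simp add: dvd_power_same)
qed

lemma fps_X_power_dvd_power_le:
  fixes f :: "'a::comm_ring_1 fps"
  assumes "f $ 0 = 0" "m \<le> n"
  shows "fps_X ^ m dvd f ^ n"
  by (rule dvd_trans[OF le_imp_power_dvd[OF assms(2)] fps_X_power_dvd_power[OF assms(1)]])

lemma tendsto_fps_iff_dvd:
  fixes f :: "'b \<Rightarrow> 'a::comm_ring_1 fps"
  shows "(f \<longlongrightarrow> L) F \<longleftrightarrow> (\<forall>N. eventually (\<lambda>x. fps_X ^ N dvd f x - L) F)"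
proof -
  have "eventually (\<lambda>x. f x $ n = L $ n) F"
    if "\<forall>N. eventually (\<lambda>x. fps_X ^ N dvd f x - L) F" for n
    using that[rule_format, of "Suc n"]
    by eventually_elim (simp add: fps_X_power_dvd_diff_iff del: power_Suc)
  moreover have "eventually (\<lambda>x. fps_X ^ N dvd f x - L) F"
    if "\<forall>n. eventually (\<lambda>x. f x $ n = L $ n) F" for N
  proof -
    have "eventually (\<lambda>x. \<forall>n\<in>{..<N}. f x $ n = L $ n) F"
      using that by (intro eventually_ball_finite) auto
    then show ?thesis by eventually_elim (simp add: fps_X_power_dvd_diff_iff)
  qed
  ultimately show ?thesis by (auto simp: tendsto_fps_iff)
qed

text \<open>The multiples of \<open>fps_X ^ N\<close> are closed under addition, so terms outside
  one good finite set cannot spoil a partial sum; one finite set for each \<open>N\<close> decides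
  convergence.\<close>

lemma has_sum_fps_iff_dvd:
  fixes f :: "'b \<Rightarrow> 'a::comm_ring_1 fps"
  shows "(f has_sum L) A \<longleftrightarrow> (\<forall>N. \<exists>F. finite F \<and> F \<subseteq> A \<and>
    (\<forall>x\<in>A - F. fps_X ^ N dvd f x) \<and> fps_X ^ N dvd sum f F - L)"
    (is "_ \<longleftrightarrow> (\<forall>N. \<exists>F. ?P N F)")
proof
  assume "(f has_sum L) A"
  then have *: "eventually (\<lambda>Y. fps_X ^ N dvd sum f Y - L) (finite_subsets_at_top A)" for N
    by (simp add: has_sum_def tendsto_fps_iff_dvd)
  show "\<forall>N. \<exists>F. ?P N F"
  proof
    fix N
    obtain F where F: "finite F" "F \<subseteq> A"
      "\<And>Y. finite Y \<Longrightarrow> F \<subseteq> Y \<Longrightarrow> Y \<subseteq> A \<Longrightarrow> fps_X ^ N dvd sum f Y - L"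
      using *[of N] unfolding eventually_finite_subsets_at_top by metis
    have "\<forall>x\<in>A - F. fps_X ^ N dvd f x"
    proof
      fix x assume x: "x \<in> A - F"
      \<comment> \<open>The partial sums over \<open>F\<close> and \<open>insert x F\<close> are
        both close to \<open>L\<close> and differ by \<open>f x\<close>.\<close>
      have "fps_X ^ N dvd (sum f (insert x F) - L) - (sum f F - L)"
        using F(1,2) x by (intro dvd_diff F(3)) auto
      then show "fps_X ^ N dvd f x" using x F(1) by simp
    qed
    with F(1,2) F(3)[of F] show "\<exists>F. ?P N F" by (intro exI[of _ F]) simp
  qed
next
  assume *: "\<forall>N. \<exists>F. ?P N F"
  show "(f has_sum L) A"
    unfolding has_sum_def tendsto_fps_iff_dvd eventually_finite_subsets_at_top
  proof
    fix N
    from spec[OF *, of N] obtain F where F: "?P N F" ..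
    have "fps_X ^ N dvd sum f Y - L" if Y: "finite Y" "F \<subseteq> Y" "Y \<subseteq> A" for Y
    proof -
      have "sum f Y - L = sum f (Y - F) + (sum f F - L)"
        using Y sum.subset_diff[of F Y f] by simp
      moreover have "fps_X ^ N dvd sum f (Y - F)" using Y F by (intro dvd_sum) auto
      ultimately show ?thesis using F by (metis dvd_add)
    qed
    with F show "\<exists>X. finite X \<and> X \<subseteq> A \<and>
      (\<forall>Y. finite Y \<and> X \<subseteq> Y \<and> Y \<subseteq> A \<longrightarrow> fps_X ^ N dvd sum f Y - L)" by blast
  qed
qed

lemma has_sum_fpsE:
  fixes f :: "'b \<Rightarrow> 'a::comm_ring_1 fps"
  assumes "(f has_sum L) A"
  obtains F where "finite F" "F \<subseteq> A" "\<forall>x\<in>A - F. fps_X ^ N dvd f x" "fps_X ^ N dvd sum f F - L"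
  using assms[unfolded has_sum_fps_iff_dvd, rule_format, of N] by auto

text \<open>Outside \<open>F \<times> G\<close> at least one of the two factors is already divisible
  by \<open>fps_X ^ N\<close>.\<close>

lemma has_sum_fps_mult:
  fixes f :: "'b \<Rightarrow> 'a::comm_ring_1 fps"
  assumes "(f has_sum L) A" "(g has_sum M) B"
  shows "((\<lambda>(x, y). f x * g y) has_sum L * M) (A \<times> B)"
  unfolding has_sum_fps_iff_dvd
proof
  fix N
  obtain F where F: "finite F" "F \<subseteq> A" "\<forall>x\<in>A - F. fps_X ^ N dvd f x" "fps_X ^ N dvd sum f F - L"
    by (rule has_sum_fpsE[OF assms(1), of N]) (rule that)
  obtain G where G: "finite G" "G \<subseteq> B" "\<forall>x\<in>B - G. fps_X ^ N dvd g x" "fps_X ^ N dvd sum g G - M"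
    by (rule has_sum_fpsE[OF assms(2), of N]) (rule that)
  have "(\<Sum>(x, y)\<in>F \<times> G. f x * g y) - L * M = (sum f F - L) * sum g G + L * (sum g G - M)"
    by (simp add: sum_product sum.cartesian_product algebra_simps)
  then have "fps_X ^ N dvd (\<Sum>(x, y)\<in>F \<times> G. f x * g y) - L * M"
    using F(4) G(4) by (simp add: dvd_add)
  moreover have "\<forall>w\<in>A \<times> B - F \<times> G. fps_X ^ N dvd (case w of (x, y) \<Rightarrow> f x * g y)"
    using F(3) G(3) by (auto intro: dvd_mult dvd_mult2)
  ultimately show "\<exists>H. finite H \<and> H \<subseteq> A \<times> B \<and>
      (\<forall>w\<in>A \<times> B - H. fps_X ^ N dvd (case w of (x, y) \<Rightarrow> f x * g y)) \<and>
      fps_X ^ N dvd (\<Sum>(x, y)\<in>H. f x * g y) - L * M"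
    using F(1,2) G(1,2) by (intro exI[of _ "F \<times> G"]) auto
qed

lemma has_sum_fps_cmult:
  fixes f :: "'b \<Rightarrow> 'a::comm_ring_1 fps"
  assumes "(f has_sum L) A"
  shows "((\<lambda>x. c * f x) has_sum c * L) A"
  unfolding has_sum_fps_iff_dvd
proof
  fix N
  obtain F where F: "finite F" "F \<subseteq> A" "\<forall>x\<in>A - F. fps_X ^ N dvd f x" "fps_X ^ N dvd sum f F - L"
    by (rule has_sum_fpsE[OF assms(1), of N]) (rule that)
  have "sum (\<lambda>x. c * f x) F - c * L = c * (sum f F - L)"
    by (simp add: sum_distrib_left algebra_simps)
  with F show "\<exists>F. finite F \<and> F \<subseteq> A \<and> (\<forall>x\<in>A - F. fps_X ^ N dvd c * f x) \<and>
      fps_X ^ N dvd (\<Sum>x\<in>F. c * f x) - c * L"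
    by (intro exI[of _ F]) auto
qed

text \<open>Regrouping needs uniformity over the classes: by \<open>small\<close>, only finitely
  many classes matter modulo \<open>fps_X ^ N\<close>, and a finite set suffices in each.\<close>

lemma has_sum_fps_UN:
  fixes f :: "'b \<Rightarrow> 'a::comm_ring_1 fps"
  assumes parts: "\<And>n. (f has_sum t n) (A n)" and total: "(t has_sum L) (UNIV :: nat set)"
    and disj: "\<And>m n. m \<noteq> n \<Longrightarrow> A m \<inter> A n = {}"
    and small: "\<And>n x. x \<in> A n \<Longrightarrow> fps_X ^ n dvd f x"
  shows "(f has_sum L) (\<Union>n. A n)"
  unfolding has_sum_fps_iff_dvd
proof
  fix N
  obtain I where I: "finite I" "\<forall>n\<in>UNIV - I. fps_X ^ N dvd t n" "fps_X ^ N dvd sum t I - L"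
    by (rule has_sum_fpsE[OF total, of N]) (rule that)
  \<comment> \<open>\<open>I\<close> controls the class sums; the indices below \<open>N\<close> are
    added so that all terms of a class outside \<open>J\<close> are divisible by
    \<open>fps_X ^ N\<close>.\<close>
  define J where "J = I \<union> {..<N}"
  have J: "finite J" "I \<subseteq> J" using I by (auto simp: J_def)
  have "sum t J - L = sum t (J - I) + (sum t I - L)"
    using J sum.subset_diff[of I J t] by simp
  moreover have "fps_X ^ N dvd sum t (J - I)" using I by (intro dvd_sum) auto
  ultimately have tJ: "fps_X ^ N dvd sum t J - L" using I(3) by (metis dvd_add)
  have "\<forall>n. \<exists>F. finite F \<and> F \<subseteq> A n \<and> (\<forall>x\<in>A n - F. fps_X ^ N dvd f x) \<and>
      fps_X ^ N dvd sum f F - t n"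
    using parts unfolding has_sum_fps_iff_dvd by simp
  then obtain F where F: "\<And>n. finite (F n)" "\<And>n. F n \<subseteq> A n"
    "\<And>n x. x \<in> A n - F n \<Longrightarrow> fps_X ^ N dvd f x" "\<And>n. fps_X ^ N dvd sum f (F n) - t n"
    by metis
  have "sum f (\<Union>n\<in>J. F n) = (\<Sum>n\<in>J. sum f (F n))"
    using J F(1,2) disj by (intro sum.UNION_disjoint) (auto, blast)
  then have "sum f (\<Union>n\<in>J. F n) - L = (\<Sum>n\<in>J. sum f (F n) - t n) + (sum t J - L)"
    by (simp add: sum_subtractf)
  moreover have "fps_X ^ N dvd (\<Sum>n\<in>J. sum f (F n) - t n)" using F(4) by (intro dvd_sum) auto
  ultimately have "fps_X ^ N dvd sum f (\<Union>n\<in>J. F n) - L" using tJ by (simp only: dvd_add)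
  moreover have "fps_X ^ N dvd f x" if "x \<in> (\<Union>n. A n) - (\<Union>n\<in>J. F n)" for x
  proof -
    obtain n where n: "x \<in> A n" using \<open>x \<in> _ - _\<close> by blast
    show ?thesis
    proof (cases "n \<in> J")
      case True
      then show ?thesis using \<open>x \<in> _ - _\<close> n F(3)[of x n] by blast
    next
      case False
      then have "N \<le> n" by (auto simp: J_def)
      then show ?thesis using dvd_trans[OF le_imp_power_dvd small[OF n]] by simp
    qed
  qed
  moreover have "finite (\<Union>n\<in>J. F n)" "(\<Union>n\<in>J. F n) \<subseteq> (\<Union>n. A n)"
    using J F(1,2) by blast+
  ultimately show "\<exists>H. finite H \<and> H \<subseteq> (\<Union>n. A n) \<and> (\<forall>x\<in>(\<Union>n. A n) - H. fps_X ^ N dvd f x) \<and>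
      fps_X ^ N dvd sum f H - L"
    by (intro exI[of _ "\<Union>n\<in>J. F n"] conjI ballI)
qed

section \<open>Reciprocals and the geometric series\<close>

lemma fps_recip_eqI:
  assumes "f $ 0 = 1" "f * g = 1"
  shows "fps_recip f = g"
proof -
  have "fps_recip f = (f * g) * fps_recip f" using assms by simp
  also have "\<dots> = g * (f * fps_recip f)" by (simp add: ac_simps)
  finally show ?thesis using assms by (simp add: fps_recip)
qed

lemma fps_recip_1 [simp]: "fps_recip 1 = 1"
  by (rule fps_recip_eqI) simp_all

lemma fps_recip_mult:
  assumes "f $ 0 = 1" "g $ 0 = 1"
  shows "fps_recip (f * g) = fps_recip f * fps_recip g"
proof (rule fps_recip_eqI)
  have "f * g * (fps_recip f * fps_recip g) = (f * fps_recip f) * (g * fps_recip g)"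
    by (simp add: ac_simps)
  then show "f * g * (fps_recip f * fps_recip g) = 1" using assms by (simp add: fps_recip)
qed (use assms in simp)

lemma fps_nth_0_dvd: "fps_X dvd (f :: 'a::comm_ring_1 fps) \<longleftrightarrow> f $ 0 = 0"
  using fps_X_power_dvd_iff[of 1 f] by simp

lemma has_sum_fps_geometric:
  fixes x :: "'a::comm_ring_1 fps"
  assumes "x $ 0 = 0"
  shows "((\<lambda>n. x ^ n) has_sum fps_recip (1 - x)) UNIV"
  unfolding has_sum_fps_iff_dvd
proof
  fix N
  have *: "(\<Sum>n<N. x ^ n) - fps_recip (1 - x) = - (x ^ N) * fps_recip (1 - x)"
  proof -
    have "(\<Sum>n<N. x ^ n) = (1 - x) * fps_recip (1 - x) * (\<Sum>n<N. x ^ n)"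
      using fps_recip[of "1 - x"] assms by simp
    also have "\<dots> = (1 - x) * (\<Sum>n<N. x ^ n) * fps_recip (1 - x)" by (simp only: ac_simps)
    also have "\<dots> = (1 - x ^ N) * fps_recip (1 - x)" by (simp add: one_diff_power_eq)
    finally show ?thesis by (simp add: algebra_simps)
  qed
  show "\<exists>F. finite F \<and> F \<subseteq> UNIV \<and> (\<forall>n\<in>UNIV - F. fps_X ^ N dvd x ^ n) \<and>
      fps_X ^ N dvd (\<Sum>n\<in>F. x ^ n) - fps_recip (1 - x)"
    by (intro exI[of _ "{..<N}"])
      (auto simp: * not_less intro: fps_X_power_dvd_power_le[OF assms] dvd_mult2)
qed

subsection \<open>A limiting case of the q-Gauss sum\<close>

lemma fps_eqI_dvd:
  fixes f g :: "'a::comm_ring_1 fps"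
  assumes "\<And>n. fps_X ^ n dvd f - g"
  shows "f = g"
proof (rule fps_ext)
  fix n show "f $ n = g $ n"
    using assms[of "Suc n"] unfolding fps_X_power_dvd_diff_iff by blast
qed

lemma dvd_mult_diff:
  fixes d :: "'a::comm_ring_1"
  assumes "d dvd a - a'" "d dvd b - b'"
  shows "d dvd a * b - a' * b'"
proof -
  have "a * b - a' * b' = (a - a') * b + a' * (b - b')" by (simp add: algebra_simps)
  then show ?thesis using assms by (metis dvd_add dvd_mult dvd_mult2)
qed

lemma fps_recip_mult_cancel_right:
  assumes "f $ 0 = 1" "g $ 0 = 1"
  shows "fps_recip (f * g) * g = fps_recip f"
proof -
  have "fps_recip (f * g) * g = fps_recip f * (g * fps_recip g)"
    using assms by (simp add: fps_recip_mult ac_simps)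
  then show ?thesis using assms by (simp add: fps_recip)
qed

section \<open>Finite and infinite q-Pochhammer products\<close>

lemma qpoch_0 [simp]: "qpoch a q 0 = 1"
  by (simp add: qpoch_def)

lemma qpoch_Suc: "qpoch a q (Suc n) = qpoch a q n * (1 - a * q ^ n)"
  by (simp add: qpoch_def)

lemma qpoch_Suc_shift: "qpoch a q (Suc n) = (1 - a) * qpoch (a * q) q n"
  by (simp add: qpoch_def prod.lessThan_Suc_shift ac_simps del: prod.lessThan_Suc)

lemma qpoch_nth_0 [simp]:
  fixes a q :: "'a::comm_ring_1 fps"
  assumes "a $ 0 = 0"
  shows "qpoch a q n $ 0 = 1"
  using assms by (induction n) (simp_all add: qpoch_Suc)

lemma qpoch_dvd_diff:
  fixes a q :: "'a::comm_ring_1 fps"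
  assumes "q $ 0 = 0" "n \<le> m"
  shows "fps_X ^ n dvd qpoch a q m - qpoch a q n"
  using assms(2)
proof (induction m rule: dec_induct)
  case (step m)
  have "fps_X ^ n dvd (qpoch a q m - qpoch a q n) - (qpoch a q m * a) * q ^ m"
    using assms(1) step.hyps
    by (intro dvd_diff[OF step.IH] dvd_mult fps_X_power_dvd_power_le) simp_all
  then show ?case by (simp add: qpoch_Suc algebra_simps)
qed simp

text \<open>The factors after the first \<open>m\<close> are \<open>1\<close> modulo
  \<open>fps_X ^ n\<close>. This explicit rate serves in the later comparisons of infinite
  products.\<close>

lemma qpoch_inf_dvd_diff:
  fixes a q :: "'a::comm_ring_1 fps"
  assumes "q $ 0 = 0" "n \<le> m"
  shows "fps_X ^ n dvd qpoch_inf a q - qpoch a q m"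
proof -
  have "eventually (\<lambda>k. fps_X ^ n dvd qpoch a q k - qpoch_inf a q) sequentially"
    using qpoch_tendsto_qpoch_inf[OF assms(1)] unfolding tendsto_fps_iff_dvd by blast
  then obtain K where K: "\<And>k. k \<ge> K \<Longrightarrow> fps_X ^ n dvd qpoch a q k - qpoch_inf a q"
    unfolding eventually_sequentially by blast
  have "fps_X ^ m dvd qpoch a q (max K m) - qpoch a q m"
    using assms(1) by (intro qpoch_dvd_diff) auto
  then have "fps_X ^ n dvd qpoch a q (max K m) - qpoch a q m"
    by (rule dvd_trans[OF le_imp_power_dvd[OF assms(2)]])
  then have "fps_X ^ n dvd (qpoch a q (max K m) - qpoch a q m) -
      (qpoch a q (max K m) - qpoch_inf a q)"
    by (rule dvd_diff) (rule K, simp)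
  then show ?thesis by simp
qed

lemma qpoch_inf_nth_0 [simp]:
  fixes a q :: "'a::comm_ring_1 fps"
  assumes "a $ 0 = 0" "q $ 0 = 0"
  shows "qpoch_inf a q $ 0 = 1"
proof -
  have "fps_X ^ 1 dvd qpoch_inf a q - qpoch a q 1"
    using assms(2) by (intro qpoch_inf_dvd_diff) simp_all
  then have "qpoch_inf a q $ 0 = qpoch a q 1 $ 0"
    unfolding fps_X_power_dvd_diff_iff by blast
  then show ?thesis using assms(1) by simp
qed

text \<open>Factors with even and with odd exponent of \<open>q\<close> are separated.\<close>

lemma qpoch_double: "qpoch a q (2 * n) = qpoch a (q ^ 2) n * qpoch (a * q) (q ^ 2) n"
  by (induction n) (simp_all add: qpoch_Suc power_mult [symmetric] ac_simps)

lemma qpoch_square: "qpoch (a ^ 2) (q ^ 2) n = qpoch a q n * qpoch (- a) q n"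
proof (induction n)
  case (Suc n)
  have "1 - a ^ 2 * (q ^ 2) ^ n = (1 - a * q ^ n) * (1 + a * q ^ n)"
    by (simp add: algebra_simps power2_eq_square power_mult_distrib)
  with Suc show ?case by (simp add: qpoch_Suc ac_simps)
qed simp

lemma qpoch_inf_double:
  fixes a q :: "'a::comm_ring_1 fps"
  assumes "q $ 0 = 0"
  shows "qpoch_inf a q = qpoch_inf a (q ^ 2) * qpoch_inf (a * q) (q ^ 2)"
proof (rule fps_eqI_dvd)
  fix n
  have "fps_X ^ n dvd (qpoch_inf a q - qpoch a q (2 * n)) -
      (qpoch_inf a (q ^ 2) * qpoch_inf (a * q) (q ^ 2)
        - qpoch a (q ^ 2) n * qpoch (a * q) (q ^ 2) n)"
    using assms by (intro dvd_diff dvd_mult_diff qpoch_inf_dvd_diff) (simp_all add: power2_eq_square)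
  then show "fps_X ^ n dvd qpoch_inf a q - qpoch_inf a (q ^ 2) * qpoch_inf (a * q) (q ^ 2)"
    by (simp add: qpoch_double)
qed

lemma qpoch_inf_square:
  fixes a q :: "'a::comm_ring_1 fps"
  assumes "q $ 0 = 0"
  shows "qpoch_inf (a ^ 2) (q ^ 2) = qpoch_inf a q * qpoch_inf (- a) q"
proof (rule fps_eqI_dvd)
  fix n
  have "fps_X ^ n dvd (qpoch_inf (a ^ 2) (q ^ 2) - qpoch (a ^ 2) (q ^ 2) n) -
      (qpoch_inf a q * qpoch_inf (- a) q - qpoch a q n * qpoch (- a) q n)"
    using assms by (intro dvd_diff dvd_mult_diff qpoch_inf_dvd_diff) (simp_all add: power2_eq_square)
  then show "fps_X ^ n dvd qpoch_inf (a ^ 2) (q ^ 2) - qpoch_inf a q * qpoch_inf (- a) q"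
    by (simp add: qpoch_square)
qed

section \<open>The series \<open>F(y, c)\<close> and its contiguity relation\<close>

text \<open>The product is \<open>y^n (-c/y; q)_n\<close> with the division multiplied out, so it
  makes sense for power series.\<close>

definition gauss_term :: "'a::comm_ring_1 fps \<Rightarrow> 'a fps \<Rightarrow> 'a fps \<Rightarrow> nat \<Rightarrow> 'a fps" where
  "gauss_term y c q n = q ^ (n choose 2) * (\<Prod>i<n. y + c * q ^ i) *
    fps_recip (qpoch q q n * qpoch c q n)"

lemma fps_X_power_dvd_prod:
  fixes f :: "nat \<Rightarrow> 'a::comm_ring_1 fps"
  assumes "\<And>i. f i $ 0 = 0"
  shows "fps_X ^ n dvd (\<Prod>i<n. f i)"
proof (induction n)
  case (Suc n)
  then show ?case
    using mult_dvd_mono[OF Suc, of fps_X "f n"] assms by (simp add: fps_nth_0_dvd mult.commute)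
qed simp

lemma fps_X_power_dvd_gauss_term:
  assumes "y $ 0 = 0" "c $ 0 = 0"
  shows "fps_X ^ n dvd gauss_term y c q n"
  unfolding gauss_term_def using assms
  by (intro dvd_mult2 dvd_mult fps_X_power_dvd_prod) simp

lemma choose_two_Suc: "Suc n choose 2 = n + (n choose 2)"
  by (simp add: numeral_2_eq_2)

text \<open>The remainder is the telescoping (WZ) certificate of the contiguity relation
  \<open>(1 - c) F(y, c) = (1 + y) F(yq, cq)\<close> for \<open>F(y, c) = (\<Sum>n. gauss_term y c q n)\<close>.\<close>

lemma gauss_term_telescope:
  fixes y c q :: "'a::comm_ring_1 fps"
  assumes "c $ 0 = 0" "q $ 0 = 0"
  shows "(1 - c) * (\<Sum>n<N. gauss_term y c q n) =
    (1 + y) * (\<Sum>n<N. gauss_term (y * q) (c * q) q n)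
      - q ^ (N choose 2) * (\<Prod>i<N. y + c * q ^ i) * fps_recip (qpoch q q N * qpoch (c * q) q N)
        * (1 - q ^ N) * (1 - c * q ^ N)"
proof (induction N)
  \<comment> \<open>In the base case the remainder vanishes through its factor
    \<open>1 - q ^ N\<close>.\<close>
  case (Suc n)
  define A where "A = q ^ (n choose 2) * (\<Prod>i<n. y + c * q ^ i)"
  define P where "P = A * fps_recip (qpoch q q n * qpoch (c * q) q n)"
  have 1: "(1 - c) * gauss_term y c q n = P * (1 - c * q ^ n)"
  proof -
    have *: "(1 - c) * qpoch (c * q) q n = qpoch c q n * (1 - c * q ^ n)"
      by (simp flip: qpoch_Suc qpoch_Suc_shift)
    have a: "fps_recip (qpoch q q n * qpoch c q n) =
        fps_recip (qpoch q q n * qpoch c q n * (1 - c * q ^ n)) * (1 - c * q ^ n)"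
      using assms by (subst fps_recip_mult_cancel_right) simp_all
    have b: "fps_recip (qpoch q q n * qpoch (c * q) q n) =
        fps_recip (qpoch q q n * qpoch (c * q) q n * (1 - c)) * (1 - c)"
      using assms by (subst fps_recip_mult_cancel_right) simp_all
    have "qpoch q q n * qpoch (c * q) q n * (1 - c) = qpoch q q n * ((1 - c) * qpoch (c * q) q n)"
      by (simp only: ac_simps)
    then have c: "qpoch q q n * qpoch (c * q) q n * (1 - c) = qpoch q q n * qpoch c q n * (1 - c * q ^ n)"
      unfolding * by (simp only: ac_simps)
    show ?thesis
      unfolding gauss_term_def P_def A_def by (subst a, subst b, subst c) (simp only: ac_simps)
  qed
  have 2: "gauss_term (y * q) (c * q) q n = q ^ n * P"
  proof -
    have "(\<Prod>i<n. y * q + c * q * q ^ i) = (\<Prod>i<n. q * (y + c * q ^ i))"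
      by (intro prod.cong) (simp_all add: algebra_simps)
    then show ?thesis by (simp add: gauss_term_def P_def A_def prod.distrib ac_simps)
  qed
  \<comment> \<open>The two trailing factors of the remainder at \<open>Suc n\<close> cancel the
    last factors of both Pochhammer products, leaving a multiple of \<open>P\<close>.\<close>
  have 3: "q ^ (Suc n choose 2) * (\<Prod>i<Suc n. y + c * q ^ i) *
      fps_recip (qpoch q q (Suc n) * qpoch (c * q) q (Suc n)) * (1 - q ^ Suc n) * (1 - c * q ^ Suc n)
      = P * q ^ n * (y + c * q ^ n)"
  proof -
    have "qpoch q q (Suc n) * qpoch (c * q) q (Suc n) =
        qpoch q q n * qpoch (c * q) q n * ((1 - q ^ Suc n) * (1 - c * q ^ Suc n))"
      by (simp add: qpoch_Suc ac_simps)
    moreover have "fps_recip (qpoch q q n * qpoch (c * q) q n * ((1 - q ^ Suc n) * (1 - c * q ^ Suc n)))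
        * ((1 - q ^ Suc n) * (1 - c * q ^ Suc n)) = fps_recip (qpoch q q n * qpoch (c * q) q n)"
      using assms by (intro fps_recip_mult_cancel_right) simp_all
    ultimately have *: "fps_recip (qpoch q q (Suc n) * qpoch (c * q) q (Suc n)) *
        ((1 - q ^ Suc n) * (1 - c * q ^ Suc n)) = fps_recip (qpoch q q n * qpoch (c * q) q n)"
      by simp
    show ?thesis
      unfolding P_def A_def choose_two_Suc power_add prod.lessThan_Suc *[symmetric]
      by (simp only: ac_simps)
  qed
  have "(1 - c) * (\<Sum>n<Suc n. gauss_term y c q n) =
      (1 + y) * (\<Sum>n<n. gauss_term (y * q) (c * q) q n) - P * (1 - q ^ n) * (1 - c * q ^ n)
      + P * (1 - c * q ^ n)"
    using Suc 1 by (simp add: distrib_left P_def A_def)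
  \<comment> \<open>Both sides exceed \<open>1 + y\<close> times the old sum by
    \<open>P * q ^ n * (1 - c * q ^ n)\<close>.\<close>
  also have "\<dots> = (1 + y) * (\<Sum>n<Suc n. gauss_term (y * q) (c * q) q n) - P * q ^ n * (y + c * q ^ n)"
    using 2 by (simp add: algebra_simps)
  finally show ?case unfolding 3 .
qed simp

text \<open>The contiguity relation is iterated \<open>k\<close> times. Each remainder contains
  \<open>N\<close> factors with zero constant term, so truncation at \<open>N\<close> costs nothing
  modulo \<open>fps_X ^ N\<close>.\<close>

lemma gauss_term_sum_shift:
  fixes y c q :: "'a::comm_ring_1 fps"
  assumes "y $ 0 = 0" "c $ 0 = 0" "q $ 0 = 0"
  shows "fps_X ^ N dvd qpoch c q k * (\<Sum>n<N. gauss_term y c q n)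
    - qpoch (- y) q k * (\<Sum>n<N. gauss_term (y * q ^ k) (c * q ^ k) q n)"
  using assms
proof (induction k arbitrary: y c)
  case (Suc k)
  let ?S = "\<lambda>y c. \<Sum>n<N. gauss_term y c q n"
  define R where "R = q ^ (N choose 2) * (\<Prod>i<N. y + c * q ^ i) *
    fps_recip (qpoch q q N * qpoch (c * q) q N) * (1 - q ^ N) * (1 - c * q ^ N)"
  have R: "fps_X ^ N dvd R"
    unfolding R_def using Suc.prems by (intro dvd_mult2 dvd_mult fps_X_power_dvd_prod) simp
  have IH: "fps_X ^ N dvd qpoch (c * q) q k * ?S (y * q) (c * q)
      - qpoch (- (y * q)) q k * ?S (y * q ^ Suc k) (c * q ^ Suc k)"
    using Suc.IH[of "y * q" "c * q"] Suc.prems by (simp add: ac_simps)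
  have "qpoch c q (Suc k) * ?S y c = qpoch (c * q) q k * ((1 - c) * ?S y c)"
    by (simp add: qpoch_Suc_shift ac_simps)
  also have "\<dots> = qpoch (c * q) q k * ((1 + y) * ?S (y * q) (c * q) - R)"
    using gauss_term_telescope[OF Suc.prems(2,3)] by (simp add: R_def)
  finally have "qpoch c q (Suc k) * ?S y c - qpoch (- y) q (Suc k) * ?S (y * q ^ Suc k) (c * q ^ Suc k)
     = (1 + y) * (qpoch (c * q) q k * ?S (y * q) (c * q)
      - qpoch (- (y * q)) q k * ?S (y * q ^ Suc k) (c * q ^ Suc k)) - qpoch (c * q) q k * R"
    by (simp add: qpoch_Suc_shift[of "- y"] algebra_simps)
  then show ?case using IH R by (metis dvd_diff dvd_mult)
qed simp

text \<open>After \<open>N\<close> shifts both parameters are divisible by \<open>q ^ N\<close>, so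
  the shifted sum is congruent to its first term \<open>1\<close> and only the two products
  remain.\<close>

lemma has_sum_gauss_term:
  fixes y c q :: "'a::comm_ring_1 fps"
  assumes "y $ 0 = 0" "c $ 0 = 0" "q $ 0 = 0"
  shows "(gauss_term y c q has_sum qpoch_inf (- y) q * fps_recip (qpoch_inf c q)) UNIV"
  unfolding has_sum_fps_iff_dvd
proof
  fix N
  let ?S = "\<Sum>n<N. gauss_term y c q n"
  define T where "T = (\<Sum>n<N. gauss_term (y * q ^ N) (c * q ^ N) q n)"
  have T: "fps_X ^ N dvd T - 1"
  proof (cases N)
    case (Suc M)
    have "fps_X ^ N dvd gauss_term (y * q ^ N) (c * q ^ N) q (Suc n)" for n
    proof -
      \<comment> \<open>For a positive index the product is not empty, and a single factor already
        supplies \<open>q ^ N\<close>.\<close>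
      have "q ^ N dvd (\<Prod>i<Suc n. y * q ^ N + c * q ^ N * q ^ i)"
        unfolding prod.lessThan_Suc by (simp add: dvd_mult dvd_add)
      then show ?thesis
        unfolding gauss_term_def using fps_X_power_dvd_power[OF assms(3)]
        by (intro dvd_mult2 dvd_mult) (rule dvd_trans)
    qed
    moreover have "T - 1 = (\<Sum>n<M. gauss_term (y * q ^ N) (c * q ^ N) q (Suc n))"
      unfolding T_def unfolding Suc sum.lessThan_Suc_shift by (simp add: gauss_term_def numeral_2_eq_2)
    ultimately show ?thesis by (simp add: dvd_sum)
  qed simp
  have "fps_X ^ N dvd (qpoch_inf (- y) q - qpoch (- y) q N) - qpoch (- y) q N * (T - 1)"
    by (rule dvd_diff[OF qpoch_inf_dvd_diff[OF assms(3)] dvd_mult[OF T]]) simp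
  moreover have "fps_X ^ N dvd (qpoch_inf c q - qpoch c q N) * ?S +
      (qpoch c q N * ?S - qpoch (- y) q N * T)"
    using assms gauss_term_sum_shift[OF assms, of N N]
    by (intro dvd_add dvd_mult2 qpoch_inf_dvd_diff) (simp_all add: T_def)
  \<comment> \<open>In this combination \<open>T\<close> and the finite products cancel.\<close>
  ultimately have "fps_X ^ N dvd ((qpoch_inf c q - qpoch c q N) * ?S +
      (qpoch c q N * ?S - qpoch (- y) q N * T)) -
      ((qpoch_inf (- y) q - qpoch (- y) q N) - qpoch (- y) q N * (T - 1))"
    by (rule dvd_diff[rotated])
  then have "fps_X ^ N dvd qpoch_inf c q * ?S - qpoch_inf (- y) q"
    by (simp add: algebra_simps)
  then have "fps_X ^ N dvd fps_recip (qpoch_inf c q) * (qpoch_inf c q * ?S - qpoch_inf (- y) q)"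
    by (rule dvd_mult)
  moreover have "fps_recip (qpoch_inf c q) * (qpoch_inf c q * ?S - qpoch_inf (- y) q) =
      (qpoch_inf c q * fps_recip (qpoch_inf c q)) * ?S - qpoch_inf (- y) q * fps_recip (qpoch_inf c q)"
    by (simp only: right_diff_distrib ac_simps)
  ultimately have "fps_X ^ N dvd ?S - qpoch_inf (- y) q * fps_recip (qpoch_inf c q)"
    using assms by (simp add: fps_recip)
  moreover have "fps_X ^ N dvd gauss_term y c q n" if "N \<le> n" for n
    by (rule dvd_trans[OF le_imp_power_dvd[OF that] fps_X_power_dvd_gauss_term[OF assms(1,2)]])
  ultimately show "\<exists>F. finite F \<and> F \<subseteq> UNIV \<and> (\<forall>n\<in>UNIV - F. fps_X ^ N dvd gauss_term y c q n) \<and>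
      fps_X ^ N dvd sum (gauss_term y c q) F - qpoch_inf (- y) q * fps_recip (qpoch_inf c q)"
    by (intro exI[of _ "{..<N}"]) auto
qed

subsection \<open>Generating functions by columns\<close>

text \<open>The default \<open>0\<close> acts as a part after the last one, so the smallest part
  also has a difference to its successor.\<close>

definition hd0 :: "nat list \<Rightarrow> nat" where
  "hd0 xs = (case xs of [] \<Rightarrow> 0 | x # _ \<Rightarrow> x)"

lemma hd0_simps [simp]: "hd0 [] = 0" "hd0 (x # xs) = x"
  by (simp_all add: hd0_def)

lemma strict_partition_Nil [simp]: "strict_partition []"
  by (simp add: strict_partition_def is_partition_def)

lemma strict_partition_Cons:
  "strict_partition (x # xs) \<longleftrightarrow> hd0 xs < x \<and> strict_partition xs"
proof -
  have "strict_partition ys \<longleftrightarrow> sorted_wrt (>) ys \<and> (\<forall>y\<in>set ys. 0 < y)" for ys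
    using sorted_wrt_mono_rel[of ys "(>)" "(\<ge>)"]
    unfolding strict_partition_def is_partition_def by auto
  then show ?thesis by (cases xs) auto
qed

lemma all_nth_Cons:
  "(\<forall>i<length (x # xs). P i ((x # xs) ! i)) \<longleftrightarrow> P 0 x \<and> (\<forall>i<length xs. P (Suc i) (xs ! i))"
  by (simp add: All_less_Suc2)

lemma Nil_in_G1' [simp]: "[] \<in> G1'" and Nil_in_G2' [simp]: "[] \<in> G2'"
  by (simp_all add: G1'_def G2'_def)

text \<open>Deleting the largest part moves all others by one position and so exchanges the two
  parity conditions.\<close>

lemma Cons_in_G1': "x # xs \<in> G1' \<longleftrightarrow> hd0 xs < x \<and> xs \<in> G2'"
  unfolding G1'_def G2'_def mem_Collect_eq strict_partition_Cons
    all_nth_Cons[of x xs "\<lambda>i y. odd i \<longrightarrow> even y"] by auto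

lemma Cons_in_G2': "x # xs \<in> G2' \<longleftrightarrow> even x \<and> hd0 xs < x \<and> xs \<in> G1'"
  unfolding G1'_def G2'_def mem_Collect_eq strict_partition_Cons
    all_nth_Cons[of x xs "\<lambda>i y. even i \<longrightarrow> even y"] by auto

lemma even_hd0_G2': "xs \<in> G2' \<Longrightarrow> even (hd0 xs)"
  by (cases xs) (auto simp: Cons_in_G2')

text \<open>The difference \<open>\<lambda>\<^sub>i - \<lambda>\<^sub>i\<^sub>+\<^sub>1\<close> counts the columns of height \<open>i\<close> in the Young diagram; \<open>u i\<close> is the
  weight of a column of height \<open>Suc i\<close>.\<close>

fun col_weight :: "(nat \<Rightarrow> 'a::comm_monoid_mult) \<Rightarrow> nat list \<Rightarrow> 'a" where
  "col_weight u [] = 1"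
| "col_weight u (x # xs) = u 0 ^ (x - hd0 xs) * col_weight (\<lambda>i. u (Suc i)) xs"

text \<open>The differences of consecutive parts add up to the largest part, the total number of
  columns, and each column yields one \<open>r\<close>.\<close>

lemma col_weight_scale:
  assumes "strict_partition xs"
  shows "col_weight (\<lambda>i. r * u i) xs = r ^ hd0 xs * col_weight u xs"
  using assms
proof (induction xs arbitrary: u)
  case (Cons x xs)
  then have "hd0 xs \<le> x" by (simp add: strict_partition_Cons)
  then have "r ^ x = r ^ (x - hd0 xs) * r ^ hd0 xs" by (simp flip: power_add)
  with Cons show ?case
    by (simp add: strict_partition_Cons power_mult_distrib ac_simps)
qed simp

text \<open>By strictness each height from \<open>1\<close> to the number of parts occurs among the
  columns.\<close>

lemma fps_X_power_dvd_col_weight: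
  fixes u :: "nat \<Rightarrow> 'a::comm_ring_1 fps"
  assumes "strict_partition xs" "\<And>i. u i $ 0 = 0"
  shows "fps_X ^ length xs dvd col_weight u xs"
  using assms
proof (induction xs arbitrary: u)
  case (Cons x xs)
  have "fps_X ^ 1 dvd u 0 ^ (x - hd0 xs)"
    using Cons.prems by (intro fps_X_power_dvd_power_le) (auto simp: strict_partition_Cons)
  moreover have "fps_X ^ length xs dvd col_weight (\<lambda>i. u (Suc i)) xs"
    using Cons.prems by (intro Cons.IH) (auto simp: strict_partition_Cons)
  ultimately show ?case by (simp add: mult_dvd_mono)
qed simp

section \<open>Multiplicities of one height and of two neighbouring heights\<close>

lemma has_sum_even_powers:
  fixes x :: "'a::comm_ring_1 fps"
  assumes "x $ 0 = 0"
  shows "((\<lambda>m. x ^ m) has_sum fps_recip (1 - x ^ 2)) {m. even m}"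
proof -
  have "((\<lambda>j. (x ^ 2) ^ j) has_sum fps_recip (1 - x ^ 2)) UNIV"
    using assms by (intro has_sum_fps_geometric) (simp add: power2_eq_square)
  then show ?thesis
    by (rule has_sum_reindex_bij_witness[of UNIV "\<lambda>m. m div 2" "\<lambda>j. 2 * j", THEN iffD1, rotated -1])
      (auto simp: power_mult)
qed

lemma has_sum_pos_powers:
  fixes x :: "'a::comm_ring_1 fps"
  assumes "x $ 0 = 0"
  shows "((\<lambda>m. x ^ m) has_sum x * fps_recip (1 - x)) {m. 0 < m}"
proof -
  have "((\<lambda>j. x * x ^ j) has_sum x * fps_recip (1 - x)) UNIV"
    using assms by (intro has_sum_fps_cmult has_sum_fps_geometric)
  then show ?thesis
    by (rule has_sum_reindex_bij_witness[of UNIV "\<lambda>m. m - 1" "Suc", THEN iffD1, rotated -1])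
      auto
qed

text \<open>In \<open>1 + x * y\<close> the first term accounts for two odd multiplicities, the
  second for two positive even ones.\<close>

definition pair_gf :: "'a::comm_ring_1 fps \<Rightarrow> 'a fps \<Rightarrow> 'a fps" where
  "pair_gf x y = x * y * (1 + x * y) * fps_recip ((1 - x ^ 2) * (1 - y ^ 2))"

lemma has_sum_even_pairs:
  fixes x y :: "'a::comm_ring_1 fps"
  assumes "x $ 0 = 0" "y $ 0 = 0"
  shows "((\<lambda>(m, n). x ^ m * y ^ n) has_sum pair_gf x y) {(m, n). 0 < m \<and> 0 < n \<and> even (m + n)}"
proof -
  \<comment> \<open>The bit \<open>e\<close> encodes the common parity; the multiplicities are
    \<open>Suc (e + 2 * i)\<close> and \<open>Suc (e + 2 * j)\<close>.\<close>
  have "((\<lambda>e. (x * y) ^ e) has_sum 1 + x * y) {0, 1::nat}"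
    by (intro has_sum_finiteI) simp_all
  moreover have "((\<lambda>(i, j). (x ^ 2) ^ i * (y ^ 2) ^ j) has_sum
      fps_recip (1 - x ^ 2) * fps_recip (1 - y ^ 2)) (UNIV \<times> UNIV)"
    using assms by (intro has_sum_fps_mult has_sum_fps_geometric) (simp_all add: power2_eq_square)
  ultimately have "((\<lambda>w. x * y * (case w of (e, v) \<Rightarrow>
      (x * y) ^ e * (case v of (i, j) \<Rightarrow> (x ^ 2) ^ i * (y ^ 2) ^ j))) has_sum
      x * y * ((1 + x * y) * (fps_recip (1 - x ^ 2) * fps_recip (1 - y ^ 2))))
      ({0, 1} \<times> (UNIV \<times> UNIV))"
    by (rule has_sum_fps_cmult[OF has_sum_fps_mult])
  also have "x * y * ((1 + x * y) * (fps_recip (1 - x ^ 2) * fps_recip (1 - y ^ 2))) = pair_gf x y"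
    using assms by (simp add: pair_gf_def fps_recip_mult power2_eq_square ac_simps)
  finally show ?thesis
  proof (rule has_sum_reindex_bij_witness[of _
        "\<lambda>(m, n). ((m - 1) mod 2, (m - 1) div 2, (n - 1) div 2)"
        "\<lambda>(e, i, j). (Suc (e + 2 * i), Suc (e + 2 * j))", THEN iffD1, rotated -1], goal_cases)
    case (3 b)
    then obtain m n where b: "b = (Suc m, Suc n)" "even (m + n)"
      by (cases b; cases "fst b"; cases "snd b") auto
    \<comment> \<open>The inverse map reads the bit off the first multiplicity only.\<close>
    then have "m mod 2 = n mod 2" by presburger
    moreover have "m mod 2 + 2 * (m div 2) = m" "n mod 2 + 2 * (n div 2) = n" by simp_all
    ultimately show ?case unfolding b by simp
  next
    case (5 a)
    then show ?case by (auto simp: power_add power_mult_distrib ac_simps simp flip: power_mult)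
  qed auto
qed

section \<open>Summation over classes of partitions with similar numbers of parts\<close>

text \<open>There are \<open>k\<close> pairs of parts, followed by one even part that may be absent,
  that is, zero.\<close>

definition G2'_class :: "nat \<Rightarrow> nat list set" where
  "G2'_class k = {xs \<in> G2'. length xs div 2 = k}"

fun add_pair :: "(nat \<times> nat) \<times> nat list \<Rightarrow> nat list" where
  "add_pair ((m, n), xs) = (m + n + hd0 xs) # (n + hd0 xs) # xs"

text \<open>\<open>m\<close> and \<open>n\<close> count the columns of height one and two. The old
  head is even, or \<open>0\<close> by default, so the new largest part is even exactly when
  \<open>m + n\<close> is; the second part is free in parity.\<close>

lemma bij_betw_add_pair:
  "bij_betw add_pair ({(m, n). 0 < m \<and> 0 < n \<and> even (m + n)} \<times> G2'_class k) (G2'_class (Suc k))"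
proof (rule bij_betw_byWitness[where f' = "\<lambda>xs. case xs of x # y # zs \<Rightarrow> ((x - y, y - hd0 zs), zs)"],
    goal_cases)
  case 2
  show ?case
  proof
    fix xs assume xs: "xs \<in> G2'_class (Suc k)"
    then obtain x y zs where "xs = x # y # zs"
      by (cases xs; cases "tl xs") (auto simp: G2'_class_def)
    with xs show "add_pair (case xs of x # y # zs \<Rightarrow> ((x - y, y - hd0 zs), zs)) = xs"
      by (auto simp: G2'_class_def Cons_in_G2' Cons_in_G1')
  qed
next
  case 3
  show ?case by (auto simp: G2'_class_def Cons_in_G2' Cons_in_G1' even_hd0_G2')
next
  case 4
  show ?case
  proof (rule image_subsetI)
    fix xs assume xs: "xs \<in> G2'_class (Suc k)"
    then obtain x y zs where "xs = x # y # zs"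
      by (cases xs; cases "tl xs") (auto simp: G2'_class_def)
    with xs show "(case xs of x # y # zs \<Rightarrow> ((x - y, y - hd0 zs), zs)) \<in>
        {(m, n). 0 < m \<and> 0 < n \<and> even (m + n)} \<times> G2'_class k"
      by (auto simp: G2'_class_def Cons_in_G2' Cons_in_G1' even_hd0_G2')
  qed
qed auto

text \<open>Two new rows on top shift all heights by two and contribute one \<open>pair_gf\<close>.
  The last factor belongs to the columns of height \<open>2 * k + 1\<close>, whose number is even
  and may be zero.\<close>

lemma has_sum_G2'_class:
  fixes u :: "nat \<Rightarrow> 'a::comm_ring_1 fps"
  assumes "\<And>i. u i $ 0 = 0"
  shows "(col_weight u has_sum
    (\<Prod>i<k. pair_gf (u (2 * i)) (u (Suc (2 * i)))) * fps_recip (1 - u (2 * k) ^ 2)) (G2'_class k)"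
  using assms
proof (induction k arbitrary: u)
  case 0
  \<comment> \<open>\<open>m\<close> is the only part, with \<open>m = 0\<close> for the empty
    partition.\<close>
  have "((\<lambda>m. u 0 ^ m) has_sum fps_recip (1 - u 0 ^ 2)) {m. even m}"
    by (intro has_sum_even_powers 0)
  then have "(col_weight u has_sum fps_recip (1 - u 0 ^ 2)) (G2'_class 0)"
  proof (rule has_sum_reindex_bij_witness[of _ hd0 "\<lambda>m. if m = 0 then [] else [m]",
        THEN iffD1, rotated -1], goal_cases)
    case (3 xs)
    then show ?case by (cases xs; cases "tl xs") (auto simp: G2'_class_def Cons_in_G2')
  next
    case (4 xs)
    then show ?case by (auto simp: G2'_class_def even_hd0_G2')
  qed (auto simp: G2'_class_def Cons_in_G2')
  then show ?case by simp
next
  case (Suc k)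
  let ?L = "(\<Prod>i<k. pair_gf (u (Suc (Suc (2 * i)))) (u (Suc (Suc (Suc (2 * i)))))) *
    fps_recip (1 - u (Suc (Suc (2 * k))) ^ 2)"
  have "(col_weight (\<lambda>i. u (Suc (Suc i))) has_sum ?L) (G2'_class k)"
    using Suc.IH[of "\<lambda>i. u (Suc (Suc i))"] Suc.prems by simp
  then have "((\<lambda>(w, xs). (case w of (m, n) \<Rightarrow> u 0 ^ m * u 1 ^ n) *
      col_weight (\<lambda>i. u (Suc (Suc i))) xs) has_sum pair_gf (u 0) (u 1) * ?L)
      ({(m, n). 0 < m \<and> 0 < n \<and> even (m + n)} \<times> G2'_class k)"
    by (intro has_sum_fps_mult has_sum_even_pairs Suc.prems)
  moreover have "(case z of (w, xs) \<Rightarrow> (case w of (m, n) \<Rightarrow> u 0 ^ m * u 1 ^ n) *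
      col_weight (\<lambda>i. u (Suc (Suc i))) xs) = col_weight u (add_pair z)" for z
    by (cases z rule: add_pair.cases) (simp add: ac_simps)
  ultimately have "((\<lambda>z. col_weight u (add_pair z)) has_sum pair_gf (u 0) (u 1) * ?L)
      ({(m, n). 0 < m \<and> 0 < n \<and> even (m + n)} \<times> G2'_class k)"
    by (rule has_sum_cong[THEN iffD1, rotated])
  then have "(col_weight u has_sum pair_gf (u 0) (u 1) * ?L) (G2'_class (Suc k))"
    by (rule has_sum_reindex_bij_betw[OF bij_betw_add_pair, THEN iffD1])
  also have "pair_gf (u 0) (u 1) * ?L = (\<Prod>i<Suc k. pair_gf (u (2 * i)) (u (Suc (2 * i)))) *
      fps_recip (1 - u (2 * Suc k) ^ 2)"
    by (simp add: prod.lessThan_Suc_shift mult.assoc del: prod.lessThan_Suc)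
  finally show ?case .
qed

text \<open>For positive \<open>k\<close> there are \<open>2 * k - 1\<close> or \<open>2 * k\<close>
  parts, so deleting the largest one leads to \<open>G2'_class (k - 1)\<close>.\<close>

definition G1'_class :: "nat \<Rightarrow> nat list set" where
  "G1'_class k = {xs \<in> G1'. Suc (length xs) div 2 = k}"

lemma G1'_class_0: "G1'_class 0 = {[]}"
proof (intro equalityI subsetI)
  fix xs assume "xs \<in> G1'_class 0"
  then show "xs \<in> {[]}" by (cases xs) (simp_all add: G1'_class_def)
qed (simp add: G1'_class_def)

text \<open>The largest part is free in parity, so columns of height one occur any positive number
  of times, independently of the rest.\<close>

lemma has_sum_G1'_class_Suc:
  fixes u :: "nat \<Rightarrow> 'a::comm_ring_1 fps"
  assumes "u 0 $ 0 = 0" and "(col_weight (\<lambda>i. u (Suc i)) has_sum L) (G2'_class k)"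
  shows "(col_weight u has_sum u 0 * fps_recip (1 - u 0) * L) (G1'_class (Suc k))"
proof -
  have "((\<lambda>(m, xs). u 0 ^ m * col_weight (\<lambda>i. u (Suc i)) xs) has_sum u 0 * fps_recip (1 - u 0) * L)
      ({m. 0 < m} \<times> G2'_class k)"
    by (intro has_sum_fps_mult has_sum_pos_powers assms)
  then show ?thesis
  proof (rule has_sum_reindex_bij_witness[of _ "\<lambda>xs. (hd0 xs - hd0 (tl xs), tl xs)"
        "\<lambda>(m, xs). (m + hd0 xs) # xs", THEN iffD1, rotated -1], goal_cases)
    case (3 xs)
    then show ?case by (cases xs) (auto simp: Cons_in_G1' G1'_class_def)
  next
    case (4 xs)
    then show ?case by (cases xs) (auto simp: Cons_in_G1' G1'_class_def G2'_class_def)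
  qed (auto simp: Cons_in_G1' G1'_class_def G2'_class_def)
qed

text \<open>The class index \<open>f\<close> is at most the number of parts, so weights in class
  \<open>k\<close> are divisible by \<open>fps_X ^ k\<close>, the uniformity required by
  \<open>has_sum_fps_UN\<close>.\<close>

lemma has_sum_col_weight_UN:
  fixes u :: "nat \<Rightarrow> 'a::comm_ring_1 fps"
  assumes "\<And>i. u i $ 0 = 0" and "\<And>k. (col_weight u has_sum t k) (C k)" and "(t has_sum L) UNIV"
    and "\<And>xs. xs \<in> G \<Longrightarrow> strict_partition xs" and "\<And>xs. f xs \<le> length xs"
    and "\<And>k. C k = {xs \<in> G. f xs = k}"
  shows "(col_weight u has_sum L) G"
proof -
  have "fps_X ^ k dvd col_weight u xs" if "xs \<in> C k" for k xs
  proof -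
    have "k \<le> length xs" "strict_partition xs" using that assms(4-6) by auto
    then show ?thesis
      using dvd_trans[OF le_imp_power_dvd fps_X_power_dvd_col_weight[of xs u]] assms(1) by blast
  qed
  then have "(col_weight u has_sum L) (\<Union>k. C k)"
    by (intro has_sum_fps_UN[OF assms(2,3)]) (auto simp: assms(6))
  also have "(\<Union>k. C k) = G" by (auto simp: assms(6))
  finally show ?thesis .
qed

lemma qpoch_inf_shift:
  fixes a q :: "'a::comm_ring_1 fps"
  assumes "q $ 0 = 0"
  shows "qpoch_inf a q = (1 - a) * qpoch_inf (a * q) q"
proof (rule fps_eqI_dvd)
  fix n
  have "fps_X ^ n dvd (qpoch_inf a q - qpoch a q (Suc n)) -
      (1 - a) * (qpoch_inf (a * q) q - qpoch (a * q) q n)"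
    using assms by (intro dvd_diff dvd_mult qpoch_inf_dvd_diff) simp_all
  then show "fps_X ^ n dvd qpoch_inf a q - (1 - a) * qpoch_inf (a * q) q"
    by (simp add: qpoch_Suc_shift algebra_simps)
qed

section \<open>Column weights for the alternating sum and the even-indexed parts\<close>

text \<open>A column of height \<open>Suc i\<close> adds \<open>1\<close> to the alternating sum if
  its height is odd and \<open>0\<close> otherwise; it adds half its height, rounded down, to the
  sum of the even-indexed parts.\<close>

definition cols :: "'a::comm_monoid_mult \<Rightarrow> 'a \<Rightarrow> nat \<Rightarrow> 'a" where
  "cols s p i = (if even i then s * p ^ (i div 2) else p ^ Suc (i div 2))"

lemma schmidt_weight_alt: "schmidt_weight xs = (\<Sum>i<length xs. if even i then xs ! i else 0)"
  unfolding schmidt_weight_def by (rule sum.mono_neutral_cong_left) auto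

lemma schmidt_weight_simps [simp]:
  "schmidt_weight [] = 0" "schmidt_weight [x] = x"
  "schmidt_weight (x # y # xs) = x + schmidt_weight xs"
  by (simp_all add: schmidt_weight_alt sum.lessThan_Suc_shift del: sum.lessThan_Suc cong: if_cong)

lemma schmidt_weight_le: "schmidt_weight xs \<le> sum_list xs"
  by (induction xs rule: induct_list012) auto

lemma alt_sum_Nil [simp]: "alt_sum [] = 0"
  by (simp add: alt_sum_def)

lemma alt_sum_conv_schmidt_weight: "alt_sum xs = 2 * int (schmidt_weight xs) - int (sum_list xs)"
  by (induction xs rule: induct_list012) (auto simp: alt_sum_Cons)

text \<open>Two new rows on top multiply the weight of each old column by \<open>p\<close>. The
  exponent of \<open>p\<close> is the sum of the even-indexed parts.\<close>

lemma col_weight_cols: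
  assumes "strict_partition xs"
  shows "col_weight (cols s p) xs = s ^ nat (alt_sum xs) * p ^ (sum_list xs - schmidt_weight xs)"
  using assms
proof (induction xs rule: induct_list012)
  case (3 x y xs)
  then have xs: "hd0 xs < y" "y < x" "strict_partition xs" by (auto simp: strict_partition_Cons)
  have "(\<lambda>i. cols s p (Suc (Suc i))) = (\<lambda>i. p * cols s p i)"
    by (auto simp: cols_def ac_simps)
  \<comment> \<open>The factor \<open>p ^ hd0 xs\<close> gained by the old columns completes the new
    columns of height two to \<open>p ^ y\<close>.\<close>
  moreover have "p ^ y = p ^ (y - hd0 xs) * p ^ hd0 xs" using xs by (simp flip: power_add)
  ultimately have "col_weight (cols s p) (x # y # xs) =
      s ^ (x - y) * p ^ y * (s ^ nat (alt_sum xs) * p ^ (sum_list xs - schmidt_weight xs))"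
    using 3(1)[OF xs(3)] xs(3) by (simp add: col_weight_scale) (simp add: cols_def ac_simps)
  moreover have "0 \<le> alt_sum xs" using xs(3) alt_sum_nonneg by (auto simp: strict_partition_def)
  then have "nat (alt_sum (x # y # xs)) = (x - y) + nat (alt_sum xs)"
    using xs by (simp add: alt_sum_Cons)
  moreover have "sum_list (x # y # xs) - schmidt_weight (x # y # xs) =
      y + (sum_list xs - schmidt_weight xs)"
    using schmidt_weight_le[of xs] by simp
  ultimately show ?case by (simp only: power_add ac_simps)
qed (simp_all add: cols_def alt_sum_Cons)

text \<open>The numerator of the factor at \<open>i\<close> is \<open>r ^ (2 * i)\<close> times a
  factor \<open>y + c * r ^ (2 * i)\<close> with \<open>y = a * b\<close> and
  \<open>c = (a * b) ^ 2\<close>, as in \<open>gauss_term\<close> with base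
  \<open>r ^ 2\<close>.\<close>

lemma prod_pair_gf:
  fixes a b r :: "'a::comm_ring_1 fps"
  assumes "a $ 0 = 0" "b $ 0 = 0"
  shows "(\<Prod>i<k. pair_gf (a * r ^ i) (b * r ^ i)) =
    (r ^ 2) ^ (k choose 2) * (\<Prod>i<k. a * b + (a * b) ^ 2 * (r ^ 2) ^ i) *
      fps_recip (qpoch (b ^ 2) (r ^ 2) k * qpoch (a ^ 2) (r ^ 2) k)"
proof (induction k)
  case (Suc k)
  have q: "(r ^ k) ^ 2 = (r ^ 2) ^ k" by (simp add: mult.commute flip: power_mult)
  have "pair_gf (a * r ^ k) (b * r ^ k) = (r ^ 2) ^ k * (a * b + (a * b) ^ 2 * (r ^ 2) ^ k) *
      fps_recip ((1 - b ^ 2 * (r ^ 2) ^ k) * (1 - a ^ 2 * (r ^ 2) ^ k))"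
    by (simp add: pair_gf_def power_mult_distrib q mult.commute)
      (simp add: q[symmetric] power2_eq_square algebra_simps)
  moreover have "fps_recip (qpoch (b ^ 2) (r ^ 2) (Suc k) * qpoch (a ^ 2) (r ^ 2) (Suc k)) =
      fps_recip (qpoch (b ^ 2) (r ^ 2) k * qpoch (a ^ 2) (r ^ 2) k) *
      fps_recip ((1 - b ^ 2 * (r ^ 2) ^ k) * (1 - a ^ 2 * (r ^ 2) ^ k))"
    using assms by (subst fps_recip_mult[symmetric])
      (simp_all add: qpoch_Suc power2_eq_square ac_simps)
  ultimately show ?case using Suc by (simp add: choose_two_Suc power_add ac_simps)
qed (simp add: numeral_2_eq_2)

text \<open>Class \<open>k\<close> gives the \<open>gauss_term\<close> with \<open>y = s * p\<close>
  and \<open>c = (s * p) ^ 2\<close> up to the constant \<open>fps_recip (1 - s ^ 2)\<close>, which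
  finally supplies the first factor of the infinite denominator.\<close>

lemma has_sum_G2'_cols:
  fixes s p :: "'a::comm_ring_1 fps"
  assumes "s $ 0 = 0" "p $ 0 = 0"
  shows "(col_weight (cols s p) has_sum
    qpoch_inf (- (s * p)) (p ^ 2) * fps_recip (qpoch_inf (s ^ 2) (p ^ 2))) G2'"
proof (rule has_sum_col_weight_UN[where C = G2'_class and f = "\<lambda>xs. length xs div 2"])
  let ?t = "\<lambda>k. fps_recip (1 - s ^ 2) * gauss_term (s * p) ((s * p) ^ 2) (p ^ 2) k"
  have p2: "p ^ 2 $ 0 = 0" and s2: "s ^ 2 $ 0 = 0" and sp: "(s * p) ^ 2 $ 0 = 0"
    using assms by (simp_all add: power2_eq_square)
  show "(col_weight (cols s p) has_sum ?t k) (G2'_class k)" for k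
  proof -
    have "(\<Prod>i<k. pair_gf (cols s p (2 * i)) (cols s p (Suc (2 * i)))) =
        (\<Prod>i<k. pair_gf (s * p ^ i) (p * p ^ i))"
      by (simp add: cols_def)
    also have "\<dots> * fps_recip (1 - cols s p (2 * k) ^ 2) = (p ^ 2) ^ (k choose 2) *
        (\<Prod>i<k. s * p + (s * p) ^ 2 * (p ^ 2) ^ i) *
        (fps_recip (qpoch (p ^ 2) (p ^ 2) k * qpoch (s ^ 2) (p ^ 2) k) *
          fps_recip (1 - s ^ 2 * (p ^ 2) ^ k))"
      using assms by (simp add: prod_pair_gf cols_def power_mult_distrib mult.assoc)
        (simp add: mult.commute flip: power_mult)
    also have "fps_recip (qpoch (p ^ 2) (p ^ 2) k * qpoch (s ^ 2) (p ^ 2) k) *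
          fps_recip (1 - s ^ 2 * (p ^ 2) ^ k) =
          fps_recip (1 - s ^ 2) * fps_recip (qpoch (p ^ 2) (p ^ 2) k * qpoch ((s * p) ^ 2) (p ^ 2) k)"
    proof -
      \<comment> \<open>The unpaired last part appends a factor; splitting off the first factor
        instead gives the shifted product.\<close>
      have "qpoch (s ^ 2) (p ^ 2) k * (1 - s ^ 2 * (p ^ 2) ^ k) =
          (1 - s ^ 2) * qpoch ((s * p) ^ 2) (p ^ 2) k"
        by (simp add: power_mult_distrib flip: qpoch_Suc qpoch_Suc_shift)
      then have "qpoch (p ^ 2) (p ^ 2) k * qpoch (s ^ 2) (p ^ 2) k * (1 - s ^ 2 * (p ^ 2) ^ k) =
          (1 - s ^ 2) * (qpoch (p ^ 2) (p ^ 2) k * qpoch ((s * p) ^ 2) (p ^ 2) k)"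
        by (simp only: mult.assoc mult.left_commute)
      then show ?thesis using p2 s2 sp by (simp flip: fps_recip_mult)
    qed
    finally show ?thesis
      using has_sum_G2'_class[of "cols s p" k] assms by (simp add: cols_def gauss_term_def ac_simps)
  qed
  have "(?t has_sum fps_recip (1 - s ^ 2) *
      (qpoch_inf (- (s * p)) (p ^ 2) * fps_recip (qpoch_inf ((s * p) ^ 2) (p ^ 2)))) UNIV"
    using p2 sp assms by (intro has_sum_fps_cmult has_sum_gauss_term) simp_all
  also have "fps_recip (1 - s ^ 2) * (qpoch_inf (- (s * p)) (p ^ 2) *
      fps_recip (qpoch_inf ((s * p) ^ 2) (p ^ 2))) =
      qpoch_inf (- (s * p)) (p ^ 2) * fps_recip (qpoch_inf (s ^ 2) (p ^ 2))"
    using p2 sp s2 unfolding qpoch_inf_shift[OF p2, of "s ^ 2"]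
    by (simp add: fps_recip_mult power_mult_distrib mult.left_commute)
  finally show "(?t has_sum qpoch_inf (- (s * p)) (p ^ 2) * fps_recip (qpoch_inf (s ^ 2) (p ^ 2))) UNIV" .
qed (use assms in \<open>auto simp: cols_def G2'_class_def G2'_def\<close>)

text \<open>Below the largest part, heights pair up with weights \<open>p\<close> and
  \<open>s * p\<close>. The factor \<open>s / (1 - s)\<close> from height one equals
  \<open>(s + s^2) / (1 - s^2)\<close> and supplies the \<open>i = 0\<close> factors, so each class
  is exactly one \<open>gauss_term\<close>.\<close>

lemma has_sum_G1'_cols:
  fixes s p :: "'a::comm_ring_1 fps"
  assumes "s $ 0 = 0" "p $ 0 = 0"
  shows "(col_weight (cols s p) has_sum
    qpoch_inf (- s) (p ^ 2) * fps_recip (qpoch_inf (s ^ 2) (p ^ 2))) G1'"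
proof (rule has_sum_col_weight_UN[where C = G1'_class and f = "\<lambda>xs. Suc (length xs) div 2"
      and t = "gauss_term s (s ^ 2) (p ^ 2)"])
  have p2: "p ^ 2 $ 0 = 0" and s2: "s ^ 2 $ 0 = 0" and sp: "(s * p) ^ 2 $ 0 = 0"
    using assms by (simp_all add: power2_eq_square)
  show "(col_weight (cols s p) has_sum gauss_term s (s ^ 2) (p ^ 2) k) (G1'_class k)" for k
  proof (cases k)
    case 0
    then show ?thesis
      by (auto simp: G1'_class_0 gauss_term_def numeral_2_eq_2 intro!: has_sum_finiteI)
  next
    case (Suc k)
    let ?u = "\<lambda>i. cols s p (Suc i)"
    \<comment> \<open>Extracting \<open>p ^ 2\<close> from each factor shifts the index by one and
      raises the exponent of the base from \<open>k choose 2\<close> to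
      \<open>Suc k choose 2\<close>.\<close>
    have prod_eq: "(\<Prod>i<k. p * (s * p) + (p * (s * p)) ^ 2 * (p ^ 2) ^ i) =
        (p ^ 2) ^ k * (\<Prod>i<k. s + s ^ 2 * (p ^ 2) ^ Suc i)"
    proof -
      have "(\<Prod>i<k. p * (s * p) + (p * (s * p)) ^ 2 * (p ^ 2) ^ i) =
          (\<Prod>i<k. p ^ 2 * (s + s ^ 2 * (p ^ 2) ^ Suc i))"
        by (intro prod.cong) (simp_all add: algebra_simps power2_eq_square)
      then show ?thesis by (simp add: prod.distrib)
    qed
    have recip_eq: "fps_recip (qpoch ((s * p) ^ 2) (p ^ 2) k * qpoch (p ^ 2) (p ^ 2) k) *
          fps_recip (1 - p ^ 2 * (p ^ 2) ^ k) =
        fps_recip (qpoch (p ^ 2) (p ^ 2) (Suc k) * qpoch ((s * p) ^ 2) (p ^ 2) k)"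
      using p2 sp by (simp add: qpoch_Suc ac_simps flip: fps_recip_mult)
    have pairs: "(\<Prod>i<k. pair_gf (?u (2 * i)) (?u (Suc (2 * i)))) =
        (\<Prod>i<k. pair_gf (p * p ^ i) ((s * p) * p ^ i))"
      by (simp add: cols_def mult.assoc)
    have "(\<Prod>i<k. pair_gf (?u (2 * i)) (?u (Suc (2 * i)))) * fps_recip (1 - ?u (2 * k) ^ 2) = (p ^ 2) ^ (k choose 2) *
        (\<Prod>i<k. p * (s * p) + (p * (s * p)) ^ 2 * (p ^ 2) ^ i) *
        (fps_recip (qpoch ((s * p) ^ 2) (p ^ 2) k * qpoch (p ^ 2) (p ^ 2) k) *
          fps_recip (1 - p ^ 2 * (p ^ 2) ^ k))"
    proof -
      have "?u (2 * k) ^ 2 = p ^ 2 * (p ^ 2) ^ k"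
        by (simp add: cols_def power_mult_distrib) (simp add: mult.commute flip: power_mult)
      then show ?thesis unfolding pairs using assms by (subst prod_pair_gf) (simp_all add: mult.assoc)
    qed
    also have "\<dots> = (p ^ 2) ^ (k choose 2) *
        ((p ^ 2) ^ k * (\<Prod>i<k. s + s ^ 2 * (p ^ 2) ^ Suc i)) *
        fps_recip (qpoch (p ^ 2) (p ^ 2) (Suc k) * qpoch ((s * p) ^ 2) (p ^ 2) k)"
      by (simp only: prod_eq recip_eq)
    finally have "(col_weight (cols s p) has_sum s * fps_recip (1 - s) *
        ((p ^ 2) ^ (k choose 2) * ((p ^ 2) ^ k * (\<Prod>i<k. s + s ^ 2 * (p ^ 2) ^ Suc i)) *
        fps_recip (qpoch (p ^ 2) (p ^ 2) (Suc k) * qpoch ((s * p) ^ 2) (p ^ 2) k))) (G1'_class (Suc k))"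
      using has_sum_G1'_class_Suc[of "cols s p", OF _ has_sum_G2'_class[of ?u k]] assms
      by (simp add: cols_def)
    also have "s * fps_recip (1 - s) *
        ((p ^ 2) ^ (k choose 2) * ((p ^ 2) ^ k * (\<Prod>i<k. s + s ^ 2 * (p ^ 2) ^ Suc i)) *
        fps_recip (qpoch (p ^ 2) (p ^ 2) (Suc k) * qpoch ((s * p) ^ 2) (p ^ 2) k)) =
        gauss_term s (s ^ 2) (p ^ 2) (Suc k)"
    proof -
      have "1 - s ^ 2 = (1 - s) * (1 + s)" by (simp add: power2_eq_square algebra_simps)
      then have "fps_recip (1 - s ^ 2) * (1 + s) = fps_recip (1 - s)"
        using fps_recip_mult_cancel_right[of "1 - s" "1 + s"] assms by simp
      moreover have "(s + s ^ 2) * fps_recip (1 - s ^ 2) = s * (fps_recip (1 - s ^ 2) * (1 + s))"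
        by (simp only: power2_eq_square algebra_simps mult_1_left mult_1_right)
      ultimately have "s * fps_recip (1 - s) = (s + s ^ 2) * fps_recip (1 - s ^ 2)"
        by simp
      moreover have "fps_recip (qpoch (p ^ 2) (p ^ 2) (Suc k) * qpoch (s ^ 2) (p ^ 2) (Suc k)) =
          fps_recip (1 - s ^ 2) *
          fps_recip (qpoch (p ^ 2) (p ^ 2) (Suc k) * qpoch ((s * p) ^ 2) (p ^ 2) k)"
        unfolding qpoch_Suc_shift[of "s ^ 2"]
        using s2 p2 sp by (simp add: power_mult_distrib ac_simps flip: fps_recip_mult)
      moreover have "(\<Prod>i<Suc k. s + s ^ 2 * (p ^ 2) ^ i) =
          (s + s ^ 2) * (\<Prod>i<k. s + s ^ 2 * (p ^ 2) ^ Suc i)"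
        by (simp only: prod.lessThan_Suc_shift power_0 mult_1_right)
      ultimately show ?thesis
        unfolding gauss_term_def choose_two_Suc power_add by (simp only: ac_simps)
    qed
    finally show ?thesis using Suc by simp
  qed
  show "(gauss_term s (s ^ 2) (p ^ 2) has_sum
      qpoch_inf (- s) (p ^ 2) * fps_recip (qpoch_inf (s ^ 2) (p ^ 2))) UNIV"
    using p2 s2 assms by (intro has_sum_gauss_term)
  show "Suc (length xs) div 2 \<le> length xs" for xs :: "nat list" by (cases xs) auto
qed (use assms in \<open>auto simp: cols_def G1'_class_def G1'_def\<close>)

section \<open>Quotients of infinite products as reciprocals\<close>

lemma fps_recip_eq_divideI:
  assumes "a * b = c" "a $ 0 = 1" "b $ 0 = 1"
  shows "a * fps_recip c = fps_recip b"
  using fps_recip_mult_cancel_right[of b a] assms by (simp add: mult.commute)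

text \<open>The denominator splits into two products with base \<open>p ^ 4\<close>; the one
  starting at \<open>s ^ 2\<close> factors by differences of squares and cancels the
  numerator.\<close>

lemma qpoch_inf_quotient_G1':
  fixes s p :: "'a::comm_ring_1 fps"
  assumes "s $ 0 = 0" "p $ 0 = 0"
  shows "qpoch_inf (- s) (p ^ 2) * fps_recip (qpoch_inf (s ^ 2) (p ^ 2)) =
    fps_recip (qpoch_inf s (p ^ 2) * qpoch_inf (s ^ 2 * p ^ 2) (p ^ 4))"
proof (rule fps_recip_eq_divideI)
  have p2: "p ^ 2 $ 0 = 0" using assms by (simp add: power2_eq_square)
  show "qpoch_inf (- s) (p ^ 2) * (qpoch_inf s (p ^ 2) * qpoch_inf (s ^ 2 * p ^ 2) (p ^ 4)) =
      qpoch_inf (s ^ 2) (p ^ 2)"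
    using qpoch_inf_double[OF p2, of "s ^ 2"] qpoch_inf_square[OF p2, of s]
    by (simp add: ac_simps flip: power_mult)
qed (use assms in \<open>simp_all add: fps_nth_power_0\<close>)

text \<open>Here the other half, starting at \<open>(s * p) ^ 2\<close>, factors and
  cancels.\<close>

lemma qpoch_inf_quotient_G2':
  fixes s p :: "'a::comm_ring_1 fps"
  assumes "s $ 0 = 0" "p $ 0 = 0"
  shows "qpoch_inf (- (s * p)) (p ^ 2) * fps_recip (qpoch_inf (s ^ 2) (p ^ 2)) =
    fps_recip (qpoch_inf (s * p) (p ^ 2) * qpoch_inf (s ^ 2) (p ^ 4))"
proof (rule fps_recip_eq_divideI)
  have p2: "p ^ 2 $ 0 = 0" using assms by (simp add: power2_eq_square)
  show "qpoch_inf (- (s * p)) (p ^ 2) * (qpoch_inf (s * p) (p ^ 2) * qpoch_inf (s ^ 2) (p ^ 4)) =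
      qpoch_inf (s ^ 2) (p ^ 2)"
    using qpoch_inf_double[OF p2, of "s ^ 2"] qpoch_inf_square[OF p2, of "s * p"]
    by (simp add: power_mult_distrib ac_simps flip: power_mult)
qed (use assms in \<open>simp_all add: fps_nth_power_0\<close>)

subsection \<open>Specialization to the two weights\<close>

lemma strict_partition_weights:
  assumes "strict_partition xs"
  shows "nat (alt_sum xs) + 2 * (sum_list xs - schmidt_weight xs) = sum_list xs"
    and "nat (alt_sum xs) + (sum_list xs - schmidt_weight xs) = schmidt_weight xs"
proof -
  have "0 \<le> alt_sum xs" using assms alt_sum_nonneg by (auto simp: strict_partition_def)
  then show "nat (alt_sum xs) + 2 * (sum_list xs - schmidt_weight xs) = sum_list xs"
    and "nat (alt_sum xs) + (sum_list xs - schmidt_weight xs) = schmidt_weight xs"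
    using schmidt_weight_le[of xs] by (simp_all add: alt_sum_conv_schmidt_weight)
qed

lemma col_weight_sum_list:
  assumes "strict_partition xs"
  shows "col_weight (cols (z * q) (q ^ 2)) xs = z ^ nat (alt_sum xs) * q ^ sum_list xs"
proof -
  have "col_weight (cols (z * q) (q ^ 2)) xs =
      z ^ nat (alt_sum xs) * q ^ (nat (alt_sum xs) + 2 * (sum_list xs - schmidt_weight xs))"
    unfolding col_weight_cols[OF assms] power_add power_mult power_mult_distrib by (simp only: ac_simps)
  then show ?thesis by (simp only: strict_partition_weights(1)[OF assms])
qed

lemma col_weight_schmidt_weight:
  assumes "strict_partition xs"
  shows "col_weight (cols (z * q) q) xs = z ^ nat (alt_sum xs) * q ^ schmidt_weight xs"
proof -
  have "col_weight (cols (z * q) q) xs =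
      z ^ nat (alt_sum xs) * q ^ (nat (alt_sum xs) + (sum_list xs - schmidt_weight xs))"
    unfolding col_weight_cols[OF assms] power_add power_mult_distrib by (simp only: ac_simps)
  then show ?thesis by (simp only: strict_partition_weights(2)[OF assms])
qed

lemma prod_add_eq_power_qpoch:
  fixes x y q :: "'a::comm_ring_1"
  shows "(\<Prod>i<n. y + y * x * q ^ i) = y ^ n * qpoch (- x) q n"
  by (induction n) (simp_all add: qpoch_Suc algebra_simps)

text \<open>Writing \<open>c = y * x\<close> recovers the usual Pochhammer form, with
  \<open>x\<close> in the role of \<open>c / y\<close>.\<close>

lemma gauss_term_eq_qpoch:
  "gauss_term y (y * x) q n = q ^ (n choose 2) * y ^ n * qpoch (- x) q n *
    fps_recip (qpoch q q n * qpoch (y * x) q n)"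
  unfolding gauss_term_def prod_add_eq_power_qpoch by (simp only: mult.assoc)

lemma choose_two_double: "(2 * n) choose 2 = 4 * (n choose 2) + n"
  by (induction n) (simp_all add: choose_two_Suc binomial_eq_0)

lemma square_eq_choose_two: "n ^ 2 = 2 * (n choose 2) + n"
  by (induction n) (simp_all add: choose_two_Suc power2_eq_square binomial_eq_0)

section \<open>Transfer to Laurent series\<close>

text \<open>The embedding preserves subdegrees, on which both metrics rest, so limits carry
  over.\<close>

lemma dist_fps_to_fls: "dist (fps_to_fls f) (fps_to_fls g) = dist f g"
proof -
  have "fls_subdegree (fps_to_fls f - fps_to_fls g) = int (subdegree (f - g))"
    using fls_subdegree_fls_to_fps[of "f - g"] by simp
  then show ?thesis by (simp add: dist_fls_def dist_fps_def)
qed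

lemma sums_fps_to_fls:
  assumes "f sums (L :: 'a::comm_ring_1 fps)"
  shows "(\<lambda>n. fps_to_fls (f n)) sums fps_to_fls L"
proof -
  have "(\<Sum>i<n. fps_to_fls (f i)) = fps_to_fls (\<Sum>i<n. f i)" for n
    by (induction n) (simp_all add: fps_to_fls_plus)
  then show ?thesis
    using assms unfolding sums_def by (simp add: tendsto_iff dist_fps_to_fls)
qed

lemma fls_X_times_X_inv: "fls_X * fls_X_inv = (1 :: 'a::comm_ring_1 fls)"
  by (simp add: fls_X_times_conv_shift)

text \<open>Here \<open>c / y = z / q\<close> is not a power series, so the Pochhammer form lives
  among Laurent series, although the whole summand comes from a power series.\<close>

lemma fps_to_fls_gauss_term:
  fixes z :: "'a::comm_ring_1 fps"
  shows "fps_to_fls (gauss_term (z * fps_X ^ 3) ((z * fps_X) ^ 2) (fps_X ^ 4) n) =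
    fps_to_fls (z ^ n * fps_X ^ ((2 * n + 1) choose 2)) *
      qpoch (- (fps_to_fls z * fls_X_inv)) (fls_X ^ 4) n *
      fps_to_fls (fps_recip (qpoch (fps_X ^ 4) (fps_X ^ 4) n *
        qpoch ((z * fps_X) ^ 2) (fps_X ^ 4) n))"
proof -
  let ?y = "fps_to_fls z * fls_X ^ 3" and ?x = "fps_to_fls z * fls_X_inv"
  have yx: "?y * ?x = (fps_to_fls z * fls_X) ^ 2"
  proof -
    have "?y * ?x = fps_to_fls z ^ 2 * fls_X ^ 2 * (fls_X * fls_X_inv)"
      by (simp add: power2_eq_square power3_eq_cube ac_simps)
    then show ?thesis by (simp add: fls_X_times_X_inv power_mult_distrib)
  qed
  have "fps_to_fls (\<Prod>i<n. z * fps_X ^ 3 + (z * fps_X) ^ 2 * (fps_X ^ 4) ^ i) =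
      (\<Prod>i<n. ?y + ?y * ?x * (fls_X ^ 4) ^ i)"
    unfolding yx
    by (induction n) (simp_all add: fls_times_fps_to_fls fps_to_fls_plus fps_to_fls_power)
  also have "\<dots> = ?y ^ n * qpoch (- ?x) (fls_X ^ 4) n"
    by (rule prod_add_eq_power_qpoch)
  also have "?y ^ n = fps_to_fls (z ^ n * fps_X ^ (3 * n))"
    by (simp add: fls_times_fps_to_fls fps_to_fls_power power_mult_distrib power_mult)
  finally have prod: "fps_to_fls (\<Prod>i<n. z * fps_X ^ 3 + (z * fps_X) ^ 2 * (fps_X ^ 4) ^ i) =
    fps_to_fls (z ^ n * fps_X ^ (3 * n)) * qpoch (- ?x) (fls_X ^ 4) n" .
  \<comment> \<open>The part \<open>3 * n\<close> stems from \<open>y ^ n\<close>, the rest from the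
    power of the base \<open>q ^ 4\<close>.\<close>
  have "(2 * n + 1) choose 2 = 4 * (n choose 2) + 3 * n"
    using choose_two_double[of n] by (simp add: choose_two_Suc)
  then have "z ^ n * fps_X ^ ((2 * n + 1) choose 2) =
      (fps_X ^ 4) ^ (n choose 2) * (z ^ n * fps_X ^ (3 * n))"
    by (simp add: power_add power_mult ac_simps)
  then have monomial: "fps_to_fls (z ^ n * fps_X ^ ((2 * n + 1) choose 2)) =
      fps_to_fls ((fps_X ^ 4) ^ (n choose 2)) * fps_to_fls (z ^ n * fps_X ^ (3 * n))"
    by (simp only: fls_times_fps_to_fls)
  show ?thesis
    unfolding gauss_term_def monomial
    unfolding fls_times_fps_to_fls[of "_ * _" "fps_recip _"] fls_times_fps_to_fls[of _ "prod _ _"] prod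
    by (simp only: mult.assoc)
qed

lemma gauss_prefactors:
  fixes z q :: "'a::comm_monoid_mult"
  shows "(q ^ 4) ^ (n choose 2) * (z * q) ^ n = z ^ n * q ^ ((2 * n) choose 2)"
    and "(q ^ 2) ^ (n choose 2) * (z * q) ^ n = z ^ n * q ^ (n ^ 2)"
    and "(q ^ 2) ^ (n choose 2) * (z * q ^ 2) ^ n = z ^ n * q ^ (n ^ 2 + n)"
  unfolding choose_two_double square_eq_choose_two
  by (simp_all add: power_mult_distrib mult.left_commute add.commute flip: power_mult power_add)

lemma monomial_powers:
  fixes z q :: "'a::comm_monoid_mult"
  shows "(q ^ 2) ^ 2 = q ^ 4" "(q ^ 2) ^ 4 = q ^ 8" "z * q * q ^ 2 = z * q ^ 3"
    "z * q * q = z * q ^ 2" "(z * q) ^ 2 = z ^ 2 * q ^ 2" "z * q * (z * q) = z ^ 2 * q ^ 2"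
    "z ^ 2 * q ^ 2 * q ^ 4 = z ^ 2 * q ^ 6" "z ^ 2 * q ^ 2 * q ^ 2 = z ^ 2 * q ^ 4"
    "z * q ^ 2 * z = z ^ 2 * q ^ 2"
  by (simp_all add: power_mult_distrib power2_eq_square power3_eq_cube eval_nat_numeral ac_simps)

lemma G1'_identities:
  fixes s p :: "'a::comm_ring_1 fps"
  assumes "s $ 0 = 0" "p $ 0 = 0" and "\<And>xs. xs \<in> G1' \<Longrightarrow> w xs = col_weight (cols s p) xs"
  defines "L \<equiv> qpoch_inf (- s) (p ^ 2) * fps_recip (qpoch_inf (s ^ 2) (p ^ 2))"
  shows "(w has_sum L) G1'" and "gauss_term s (s ^ 2) (p ^ 2) sums L"
proof -
  show "(w has_sum L) G1'"
    using has_sum_G1'_cols[OF assms(1,2)] unfolding L_def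
    by (rule has_sum_cong[THEN iffD2, rotated]) (rule assms(3))
  show "gauss_term s (s ^ 2) (p ^ 2) sums L"
    unfolding L_def using assms(1,2)
    by (intro has_sum_imp_sums has_sum_gauss_term) (simp_all add: power2_eq_square)
qed

text \<open>This series has \<open>c = s ^ 2\<close>, whereas the grouping in
  \<open>has_sum_G2'_cols\<close> has \<open>c = (s * p) ^ 2\<close>. They need not agree term by
  term, but \<open>has_sum_gauss_term\<close> leads both to the same value.\<close>

lemma G2'_identities:
  fixes s p :: "'a::comm_ring_1 fps"
  assumes "s $ 0 = 0" "p $ 0 = 0" and "\<And>xs. xs \<in> G2' \<Longrightarrow> w xs = col_weight (cols s p) xs"
  defines "L \<equiv> qpoch_inf (- (s * p)) (p ^ 2) * fps_recip (qpoch_inf (s ^ 2) (p ^ 2))"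
  shows "(w has_sum L) G2'" and "gauss_term (s * p) (s ^ 2) (p ^ 2) sums L"
proof -
  show "(w has_sum L) G2'"
    using has_sum_G2'_cols[OF assms(1,2)] unfolding L_def
    by (rule has_sum_cong[THEN iffD2, rotated]) (rule assms(3))
  show "gauss_term (s * p) (s ^ 2) (p ^ 2) sums L"
    unfolding L_def using assms(1,2)
    by (intro has_sum_imp_sums has_sum_gauss_term) (simp_all add: power2_eq_square)
qed

theorem theorem7p5:
  shows "((\<lambda>xs. zv ^ nat (alt_sum xs) * qv ^ sum_list xs) has_sum
        qpoch_inf (- (zv * qv)) (qv ^ 4) * fps_recip (qpoch_inf (zv ^ 2 * qv ^ 2) (qv ^ 4))) G1' \<and>
    ((\<lambda>n. zv ^ n * qv ^ ((2 * n) choose 2) * qpoch (- (zv * qv)) (qv ^ 4) n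
          * fps_recip (qpoch (qv ^ 4) (qv ^ 4) n * qpoch (zv ^ 2 * qv ^ 2) (qv ^ 4) n))
      sums (qpoch_inf (- (zv * qv)) (qv ^ 4) * fps_recip (qpoch_inf (zv ^ 2 * qv ^ 2) (qv ^ 4)))) \<and>
    (qpoch_inf (- (zv * qv)) (qv ^ 4) * fps_recip (qpoch_inf (zv ^ 2 * qv ^ 2) (qv ^ 4))
      = fps_recip (qpoch_inf (zv * qv) (qv ^ 4) * qpoch_inf (zv ^ 2 * qv ^ 6) (qv ^ 8))) \<and>

    ((\<lambda>xs. zv ^ nat (alt_sum xs) * qv ^ sum_list xs) has_sum
        qpoch_inf (- (zv * qv ^ 3)) (qv ^ 4) * fps_recip (qpoch_inf (zv ^ 2 * qv ^ 2) (qv ^ 4))) G2' \<and>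
    ((\<lambda>n. fps_to_fls (zv ^ n * qv ^ ((2 * n + 1) choose 2))
          * qpoch (- (fps_to_fls zv * fls_X_inv)) (fls_X ^ 4) n
          * fps_to_fls (fps_recip (qpoch (qv ^ 4) (qv ^ 4) n * qpoch (zv ^ 2 * qv ^ 2) (qv ^ 4) n)))
      sums fps_to_fls
        (qpoch_inf (- (zv * qv ^ 3)) (qv ^ 4) * fps_recip (qpoch_inf (zv ^ 2 * qv ^ 2) (qv ^ 4)))) \<and>
    (qpoch_inf (- (zv * qv ^ 3)) (qv ^ 4) * fps_recip (qpoch_inf (zv ^ 2 * qv ^ 2) (qv ^ 4))
      = fps_recip (qpoch_inf (zv * qv ^ 3) (qv ^ 4) * qpoch_inf (zv ^ 2 * qv ^ 2) (qv ^ 8))) \<and>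

    ((\<lambda>xs. zv ^ nat (alt_sum xs) * qv ^ schmidt_weight xs) has_sum
        qpoch_inf (- (zv * qv)) (qv ^ 2) * fps_recip (qpoch_inf (zv ^ 2 * qv ^ 2) (qv ^ 2))) G1' \<and>
    ((\<lambda>n. zv ^ n * qv ^ (n ^ 2) * qpoch (- (zv * qv)) (qv ^ 2) n
          * fps_recip (qpoch (qv ^ 2) (qv ^ 2) n * qpoch (zv ^ 2 * qv ^ 2) (qv ^ 2) n))
      sums (qpoch_inf (- (zv * qv)) (qv ^ 2) * fps_recip (qpoch_inf (zv ^ 2 * qv ^ 2) (qv ^ 2)))) \<and>
    (qpoch_inf (- (zv * qv)) (qv ^ 2) * fps_recip (qpoch_inf (zv ^ 2 * qv ^ 2) (qv ^ 2))
      = fps_recip (qpoch_inf (zv * qv) (qv ^ 2) * qpoch_inf (zv ^ 2 * qv ^ 4) (qv ^ 4))) \<and>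

    ((\<lambda>xs. zv ^ nat (alt_sum xs) * qv ^ schmidt_weight xs) has_sum
        qpoch_inf (- (zv * qv ^ 2)) (qv ^ 2) * fps_recip (qpoch_inf (zv ^ 2 * qv ^ 2) (qv ^ 2))) G2' \<and>
    ((\<lambda>n. zv ^ n * qv ^ (n ^ 2 + n) * qpoch (- zv) (qv ^ 2) n
          * fps_recip (qpoch (qv ^ 2) (qv ^ 2) n * qpoch (zv ^ 2 * qv ^ 2) (qv ^ 2) n))
      sums (qpoch_inf (- (zv * qv ^ 2)) (qv ^ 2) * fps_recip (qpoch_inf (zv ^ 2 * qv ^ 2) (qv ^ 2)))) \<and>
    (qpoch_inf (- (zv * qv ^ 2)) (qv ^ 2) * fps_recip (qpoch_inf (zv ^ 2 * qv ^ 2) (qv ^ 2))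
      = fps_recip (qpoch_inf (zv * qv ^ 2) (qv ^ 2) * qpoch_inf (zv ^ 2 * qv ^ 2) (qv ^ 4)))"
proof -
  note pow = monomial_powers(1,2)[of qv] monomial_powers(3-)[of zv qv]
  have zero: "(zv * qv) $ 0 = 0" "qv $ 0 = 0" "(qv ^ 2) $ 0 = 0"
    by simp_all
  have strict: "strict_partition xs" if "xs \<in> G1' \<or> xs \<in> G2'" for xs
    using that by (auto simp: G1'_def G2'_def)
  \<comment> \<open>Always \<open>s = zv * qv\<close>; \<open>p = qv ^ 2\<close> records the weight
    and \<open>p = qv\<close> the Schmidt weight.\<close>
  note G1w = G1'_identities[OF zero(1,3), of "\<lambda>xs. zv ^ nat (alt_sum xs) * qv ^ sum_list xs",
      OF col_weight_sum_list[symmetric, OF strict[OF disjI1]], unfolded pow]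
  note G2w = G2'_identities[OF zero(1,3), of "\<lambda>xs. zv ^ nat (alt_sum xs) * qv ^ sum_list xs",
      OF col_weight_sum_list[symmetric, OF strict[OF disjI2]], unfolded pow]
  note G1s = G1'_identities[OF zero(1,2), of "\<lambda>xs. zv ^ nat (alt_sum xs) * qv ^ schmidt_weight xs",
      OF col_weight_schmidt_weight[symmetric, OF strict[OF disjI1]], unfolded pow]
  note G2s = G2'_identities[OF zero(1,2), of "\<lambda>xs. zv ^ nat (alt_sum xs) * qv ^ schmidt_weight xs",
      OF col_weight_schmidt_weight[symmetric, OF strict[OF disjI2]], unfolded pow]
  note Q1w = qpoch_inf_quotient_G1'[OF zero(1,3), unfolded pow]
  note Q2w = qpoch_inf_quotient_G2'[OF zero(1,3), unfolded pow]
  note Q1s = qpoch_inf_quotient_G1'[OF zero(1,2), unfolded pow]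
  note Q2s = qpoch_inf_quotient_G2'[OF zero(1,2), unfolded pow]
  have T1w: "gauss_term (zv * qv) (zv ^ 2 * qv ^ 2) (qv ^ 4) = (\<lambda>n. zv ^ n * qv ^ ((2 * n) choose 2) *
      qpoch (- (zv * qv)) (qv ^ 4) n *
      fps_recip (qpoch (qv ^ 4) (qv ^ 4) n * qpoch (zv ^ 2 * qv ^ 2) (qv ^ 4) n))"
    \<comment> \<open>Since \<open>c = y ^ 2\<close>, the quotient \<open>c / y\<close> is
      \<open>y\<close> itself.\<close>
    using gauss_term_eq_qpoch[of "zv * qv" "zv * qv" "qv ^ 4"]
    unfolding pow gauss_prefactors(1) by (rule ext)
  have T1s: "gauss_term (zv * qv) (zv ^ 2 * qv ^ 2) (qv ^ 2) = (\<lambda>n. zv ^ n * qv ^ (n ^ 2) *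
      qpoch (- (zv * qv)) (qv ^ 2) n *
      fps_recip (qpoch (qv ^ 2) (qv ^ 2) n * qpoch (zv ^ 2 * qv ^ 2) (qv ^ 2) n))"
    using gauss_term_eq_qpoch[of "zv * qv" "zv * qv" "qv ^ 2"]
    unfolding pow gauss_prefactors(2) by (rule ext)
  have T2s: "gauss_term (zv * qv ^ 2) (zv ^ 2 * qv ^ 2) (qv ^ 2) = (\<lambda>n. zv ^ n * qv ^ (n ^ 2 + n) *
      qpoch (- zv) (qv ^ 2) n *
      fps_recip (qpoch (qv ^ 2) (qv ^ 2) n * qpoch (zv ^ 2 * qv ^ 2) (qv ^ 2) n))"
    using gauss_term_eq_qpoch[of "zv * qv ^ 2" zv "qv ^ 2"]
    unfolding pow gauss_prefactors(3) by (rule ext)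
  note T2w = sums_fps_to_fls[OF G2w(2),
      unfolded fps_to_fls_gauss_term[of zv, unfolded pow]]
  show ?thesis
    by (intro conjI G1w(1) G2w(1) G1s(1) G2s(1) Q1w Q2w Q1s Q2s T2w
        G1w(2)[unfolded T1w] G1s(2)[unfolded T1s] G2s(2)[unfolded T2s])
qed

end
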